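(* Let $\delta>0$, $\eta>0$, $\lambda>0$, $n=\lceil\delta\rceil$, and let $\nu>0$ be such that $\nu n\in(0,1)$. Let $N(t)$, $t\ge0$, be a homogeneous Poisson process of rate $\lambda$ independent of the process ${}_\eta\mathfrak{V}_t^{\nu,\delta}$, $t\ge0$. Then the state probability distribution $p_k(t)=\mathbb{P}[N({}_\eta\mathfrak{V}_t^{\nu,\delta})=k]$, $k\ge0$, $t\ge0$, reads $$p_k(t)=e^{t\eta^\delta}\frac{(-1)^k}{k!}\sum_{m=0}^\infty\frac{\Gamma(\nu m+1)}{m!\,\Gamma(\nu m-k+1)}\left(\frac{\lambda^\nu}{\eta}\right)^m\sum_{r=0}^\infty\frac{(-t\eta^\delta)^r\,\Gamma(r\delta+1)}{r!\,\Gamma(r\delta-m+1)}$$ $$=e^{t\eta^\delta}\frac{(-1)^k}{k!}\sum_{m=0}^\infty\frac{\Gamma(\nu m+1)}{m!\,\Gamma(\nu m-k+1)}\left(\frac{\lambda^\nu}{\eta}\right)^m{}_1\psi_1\left[\left.\begin{array}{l}(1,\delta)\\(1-m,\delta)\end{array}\right|-\eta^\delta t\right].$$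
   Context: A subordinator is a process $S_t$, $t\ge0$, starting from zero, with increasing paths and with independent and stationary increments; its Laplace exponent $\Phi$ is defined by $\mathbb{E}e^{-\mu S_t}=e^{-t\Phi(\mu)}$. For $\beta\in(0,1)$, a $\beta$-stable subordinator $V_t^\beta$ has Laplace exponent $\mu^\beta$. With $\nu n\in(0,1)$, let $V^{\nu r}_t$, $r=1,\dots,n$, be independent $\nu r$-stable subordinators and ${}_\eta\mathcal{V}_t^{\nu,n}=\sum_{r=1}^n\binom{n}{r}^{1/(\nu r)}\eta^{(n-r)/(\nu r)}V_t^{\nu r}$. Let $\mathscr{V}_t^{\delta/n}$ be a subordinator, independent of the $V^{\nu r}$, with Laplace exponent $(\eta^n+\mu)^{\delta/n}-\eta^\delta$. Define ${}_\eta\mathfrak{V}_t^{\nu,\delta}={}_\eta\mathcal{V}^{\nu,n}_{\mathscr{V}_t^{\delta/n}}$. The generalized Wright function is ${}_1\psi_1\left[\left.\begin{array}{l}(a,\alpha)\\(b,\beta)\end{array}\right|z\right]=\sum_{r=0}^\infty\frac{\Gamma(a+\alpha r)}{\Gamma(b+\beta r)}\frac{z^r}{r!}$. The convention $1/\Gamma(x)=0$ for $x\in\{0,-1,-2,\dots\}$ is used.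
   Formalization: The formula for p_k(t) is claimed whenever the outer series over m converges (proved for λ^ν<η or integer δ); for λ^ν>η, non-integer δ and t>0 it can diverge, e.g. at k=0. Paths of the subordinators and of N are taken right-continuous. *)

theory Defs
  imports "HOL-Probability.Probability"
begin

text \<open>
  Processes are indexed by \<open>real\<close>; only their values at times \<open>t \<ge> 0\<close> matter.
\<close>

definition process_events :: "'a measure \<Rightarrow> (real \<Rightarrow> 'a \<Rightarrow> 'b::topological_space) \<Rightarrow> 'a set set" where
  "process_events M X =
     sigma_sets (space M) (\<Union>t\<in>{0..}. {X t -` B \<inter> space M | B. B \<in> sets borel})"

definition family_events ::
    "'a measure \<Rightarrow> 'i set \<Rightarrow> ('i \<Rightarrow> real \<Rightarrow> 'a \<Rightarrow> 'b::topological_space) \<Rightarrow> 'a set set" where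
  "family_events M I X = sigma_sets (space M) (\<Union>i\<in>I. process_events M (X i))"

definition independent_increments ::
    "'a measure \<Rightarrow> (real \<Rightarrow> 'a \<Rightarrow> 'b::{topological_space, minus}) \<Rightarrow> bool" where
  "independent_increments M X \<longleftrightarrow>
     (\<forall>(m::nat) \<tau>. 0 \<le> \<tau> 0 \<longrightarrow> (\<forall>i<m. \<tau> i \<le> \<tau> (Suc i)) \<longrightarrow>
        prob_space.indep_vars M (\<lambda>_. borel) (\<lambda>i \<omega>. X (\<tau> (Suc i)) \<omega> - X (\<tau> i) \<omega>) {..<m})"

definition stationary_increments :: "'a measure \<Rightarrow> (real \<Rightarrow> 'a \<Rightarrow> real) \<Rightarrow> bool" where
  "stationary_increments M X \<longleftrightarrow>
     (\<forall>s\<ge>0. \<forall>h\<ge>0. distr M borel (\<lambda>\<omega>. X (s + h) \<omega> - X s \<omega>)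
                  = distr M borel (\<lambda>\<omega>. X h \<omega> - X 0 \<omega>))"

text \<open>
  Right-continuity of the paths is the usual regularity convention for Levy processes. Together
  with monotonicity it makes \<open>(t, \<omega>) \<mapsto> X t \<omega>\<close> jointly measurable, so that a process evaluated at
  a random time is a random variable. ``Increasing'' means nondecreasing.
\<close>

definition increasing_rc_paths ::
    "'a measure \<Rightarrow> (real \<Rightarrow> 'a \<Rightarrow> 'b::{topological_space, order}) \<Rightarrow> bool" where
  "increasing_rc_paths M X \<longleftrightarrow>
     (\<forall>\<omega>\<in>space M. mono_on {0..} (\<lambda>t. X t \<omega>) \<and> (\<forall>t\<ge>0. continuous (at_right t) (\<lambda>s. X s \<omega>)))"

definition subordinator :: "'a measure \<Rightarrow> (real \<Rightarrow> 'a \<Rightarrow> real) \<Rightarrow> bool" where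
  "subordinator M S \<longleftrightarrow>
     (\<forall>t\<ge>0. S t \<in> borel_measurable M) \<and>
     (\<forall>\<omega>\<in>space M. S 0 \<omega> = 0) \<and>
     increasing_rc_paths M S \<and>
     independent_increments M S \<and>
     stationary_increments M S"

definition has_laplace_exponent ::
    "'a measure \<Rightarrow> (real \<Rightarrow> 'a \<Rightarrow> real) \<Rightarrow> (real \<Rightarrow> real) \<Rightarrow> bool" where
  "has_laplace_exponent M S \<Phi> \<longleftrightarrow>
     (\<forall>t\<ge>0. \<forall>\<mu>\<ge>0. prob_space.expectation M (\<lambda>\<omega>. exp (- \<mu> * S t \<omega>)) = exp (- t * \<Phi> \<mu>))"

definition stable_subordinator :: "'a measure \<Rightarrow> real \<Rightarrow> (real \<Rightarrow> 'a \<Rightarrow> real) \<Rightarrow> bool" where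
  "stable_subordinator M \<beta> S \<longleftrightarrow>
     0 < \<beta> \<and> \<beta> < 1 \<and> subordinator M S \<and> has_laplace_exponent M S (\<lambda>\<mu>. \<mu> powr \<beta>)"

text \<open>
  The increments of \<open>N\<close> below are differences in \<open>nat\<close>; since the paths are nondecreasing, no
  truncation occurs.
\<close>

definition poisson_process :: "'a measure \<Rightarrow> real \<Rightarrow> (real \<Rightarrow> 'a \<Rightarrow> nat) \<Rightarrow> bool" where
  "poisson_process M rate N \<longleftrightarrow>
     (\<forall>t\<ge>0. N t \<in> measurable M (count_space UNIV)) \<and>
     (\<forall>\<omega>\<in>space M. N 0 \<omega> = 0) \<and>
     increasing_rc_paths M N \<and>
     independent_increments M N \<and>
     (\<forall>s\<ge>0. \<forall>h>0. distr M (count_space UNIV) (\<lambda>\<omega>. N (s + h) \<omega> - N s \<omega>)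
                  = measure_pmf (poisson_pmf (rate * h)))"

definition stable_mixture ::
    "real \<Rightarrow> real \<Rightarrow> nat \<Rightarrow> (nat \<Rightarrow> real \<Rightarrow> 'a \<Rightarrow> real) \<Rightarrow> real \<Rightarrow> 'a \<Rightarrow> real" where
  "stable_mixture \<eta> \<nu> n V t \<omega> =
     (\<Sum>r=1..n. real (n choose r) powr (1 / (\<nu> * real r))
               * \<eta> powr (real (n - r) / (\<nu> * real r)) * V r t \<omega>)"

definition time_change :: "(real \<Rightarrow> 'a \<Rightarrow> 'b) \<Rightarrow> (real \<Rightarrow> 'a \<Rightarrow> real) \<Rightarrow> real \<Rightarrow> 'a \<Rightarrow> 'b" where
  "time_change X T t \<omega> = X (T t \<omega>) \<omega>"

text \<open>
  \<open>rGamma\<close> vanishes at the poles of \<open>Gamma\<close>, which is the convention \<open>1 / \<Gamma>(x) = 0\<close> for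
  \<open>x = 0, -1, -2, \<dots>\<close>.
\<close>

definition wright_1psi1 :: "real \<Rightarrow> real \<Rightarrow> real \<Rightarrow> real \<Rightarrow> real \<Rightarrow> real" where
  "wright_1psi1 a \<alpha> b \<beta> z =
     (\<Sum>r. Gamma (a + \<alpha> * real r) * rGamma (b + \<beta> * real r) * (z ^ r / fact r))"

end

theory Submission
  imports Defs "HOL-Complex_Analysis.Conformal_Mappings"
begin

text \<open>
  Conditioning on the time change gives the Laplace transform
  \<open>F(x) = exp (t \<eta>\<^sup>\<delta>) exp (- t (\<eta> + x\<^sup>\<nu>)\<^sup>\<delta>)\<close> of the random time, and \<open>p\<^sub>k\<close> as a function of the
  Poisson rate satisfies \<open>\<Sum>\<^sub>k p\<^sub>k(x) s\<^sup>k = F(x (1 - s))\<close>. No derivative of \<open>F\<close> is needed: expand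
  \<open>F\<close> as a power series in \<open>x\<^sup>\<nu> / \<eta>\<close>, expand each \<open>(1 - s)\<^bsup>\<nu>m\<^esup>\<close> by the binomial series,
  interchange the sums and compare coefficients of \<open>s\<^sup>k\<close>.

  The expansion of \<open>F\<close> is elementary only for \<open>x\<^sup>\<nu> < \<eta>\<close>. If the series for \<open>p\<^sub>k\<close> converges at some
  rate with \<open>x\<^sup>\<nu> > \<eta>\<close>, then the radius of convergence of the expansion exceeds 1, and the identity
  theorem extends it. The interchange of sums is absolute only below the given rate, which is
  reached in the end by Abel's limit theorem.
\<close>

subsection \<open>Power series\<close>

text \<open>Shifting the argument of \<open>rGamma\<close> up by \<open>m\<close> produces a
  Pochhammer factor, and this stays valid at the poles of Gamma, so the convention 1/Gamma = 0 needs
  no case split. The bound \<open>a > -1\<close> makes \<open>Gamma (a + 1)\<close> positive. This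
  turns every Gamma quotient of the theorem into a binomial coefficient.\<close>

lemma Gamma_rGamma_eq_gbinomial:
  assumes "a > (-1 :: real)"
  shows "Gamma (a + 1) * rGamma (a - real m + 1) = fact m * (a gchoose m)"
proof -
  have "rGamma (a - real m + 1) = pochhammer (a - real m + 1) m * rGamma (a - real m + 1 + of_nat m)"
    by (rule pochhammer_rGamma)
  also have "a - real m + 1 + of_nat m = a + 1" by simp
  finally have "Gamma (a + 1) * rGamma (a - real m + 1)
      = pochhammer (a - real m + 1) m * (Gamma (a + 1) * rGamma (a + 1))"
    by simp
  also have "Gamma (a + 1) * rGamma (a + 1) = 1"
    using Gamma_real_pos[of "a + 1"] assms
    by (metis less_irrefl minus_less_iff neg_less_iff_less real_0_less_add_iff rGamma_inverse_Gamma right_inverse add.commute)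
  finally show ?thesis
    by (simp add: gbinomial_pochhammer')
qed

text \<open>Each factor satisfies |a - i| \<le> a + i. The bound is the nonnegative coefficient of
  w^m in (1 - w)^(-a), so a majorant of the binomial series with a closed sum is at hand.\<close>

lemma abs_gbinomial_le:
  assumes "(a::real) \<ge> 0"
  shows "\<bar>a gchoose m\<bar> \<le> (-1) ^ m * (- a gchoose m)"
proof -
  have "\<bar>a gchoose m\<bar> = (\<Prod>i<m. \<bar>a - real i\<bar>) / fact m"
    by (simp add: gbinomial_prod_rev abs_prod atLeast0LessThan)
  also have "\<dots> \<le> (\<Prod>i<m. a + real i) / fact m"
    using assms by (intro divide_right_mono prod_mono) auto
  also have "(\<Prod>i<m. a + real i) = (\<Prod>i<m. (-1) * (- a - real i))"
    by (intro prod.cong) auto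
  also have "\<dots> = (-1) ^ m * (\<Prod>i<m. - a - real i)"
    by (simp only: prod.distrib prod_constant card_lessThan)
  finally show ?thesis
    by (simp add: gbinomial_prod_rev atLeast0LessThan)
qed

lemma binomial_majorant_sums:
  assumes "0 \<le> w" "w < (1::real)"
  shows "(\<lambda>m. (-1) ^ m * (- a gchoose m) * w ^ m) sums (1 - w) powr (- a)"
proof -
  have "(\<lambda>m. (- a gchoose m) * (- w) ^ m) sums (1 + (- w)) powr (- a)"
    using assms by (intro gen_binomial_real) auto
  then show ?thesis
    by (simp add: power_minus[of w] mult_ac)
qed

text \<open>For a natural exponent the series terminates, hence no bound \<open>w < 1\<close>. This
  is the source of the unrestricted convergence for integer \<delta>.\<close>

lemma gbinomial_nat_power_sums:
  assumes "w \<ge> (0::real)"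
  shows "(\<lambda>m. (real N gchoose m) * w ^ m) sums (1 + w) ^ N"
proof -
  have "(\<lambda>m. (real N gchoose m) * w ^ m) sums (\<Sum>m\<le>N. (real N gchoose m) * w ^ m)"
    by (intro sums_finite) (auto simp: binomial_gbinomial[symmetric])
  also have "(\<Sum>m\<le>N. (real N gchoose m) * w ^ m) = (w + 1) ^ N"
    by (simp add: binomial_ring binomial_gbinomial[symmetric])
  finally show ?thesis by (simp add: add.commute)
qed

text \<open>Fubini for absolutely convergent double series, with a majorant whose row sums are known
  explicitly. The proof passes to unordered sums over pairs and returns to ordered series at the
  end.\<close>

lemma double_series_swap:
  fixes f g :: "nat \<Rightarrow> nat \<Rightarrow> real"
  assumes le: "\<And>r m. \<bar>f r m\<bar> \<le> g r m"
    and g: "\<And>r. g r sums G r" and G: "summable G"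
    and f: "\<And>r. f r sums F r"
  shows "\<And>m. summable (\<lambda>r. f r m)"
    and "summable (\<lambda>m. \<bar>\<Sum>r. f r m\<bar>)"
    and "(\<lambda>m. \<Sum>r. f r m) sums (\<Sum>r. F r)"
proof -
  have g0: "g r m \<ge> 0" for r m using le[of r m] by linarith
  have G0: "G r \<ge> 0" for r using g[of r] g0 sums_le[of "\<lambda>_. 0" "g r" 0] by auto
  have gs: "(g r has_sum G r) UNIV" for r
    using g g0 by (intro sums_nonneg_imp_has_sum)
  \<comment> \<open>For nonnegative terms, summable row sums already give summability over all
    pairs.\<close>
  have sg: "(\<lambda>(r, m). g r m) summable_on UNIV \<times> UNIV"
  proof (rule summable_on_SigmaI[where g = G])
    show "G summable_on UNIV" using G G0 by (simp add: summable_on_UNIV_nonneg_real_iff)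
  qed (use gs g0 in auto)
  have abs: "(\<lambda>x. norm (case x of (r, m) \<Rightarrow> f r m)) summable_on UNIV \<times> UNIV"
    by (rule Infinite_Sum.abs_summable_on_comparison_test'[OF sg]) (auto simp: le)
  then have sf: "(\<lambda>(r, m). f r m) summable_on UNIV \<times> UNIV"
    by (rule abs_summable_summable)
  have sf': "(\<lambda>(m, r). f r m) summable_on UNIV \<times> UNIV"
    using sf summable_on_swap[of "\<lambda>(r, m). f r m" UNIV UNIV] by auto
  have abs': "(\<lambda>(m, r). \<bar>f r m\<bar>) summable_on UNIV \<times> UNIV"
    using abs summable_on_swap[of "\<lambda>x. norm (case x of (r, m) \<Rightarrow> f r m)" UNIV UNIV]
    by (auto simp: case_prod_unfold)
  have fr: "(\<lambda>r. f r m) summable_on UNIV" for m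
    using summable_on_SigmaD1[OF sf', of m] by simp
  then show "summable (\<lambda>r. f r m)" for m by (rule summable_on_imp_summable)
  have fr': "(\<lambda>r. \<bar>f r m\<bar>) summable_on UNIV" for m
    using summable_on_SigmaD1[OF abs', of m] by simp
  have eq: "(\<Sum>\<^sub>\<infinity>r. f r m) = (\<Sum>r. f r m)" for m
    using has_sum_imp_sums[OF has_sum_infsum[OF fr]] by (simp add: sums_iff)
  have eqF: "(\<Sum>\<^sub>\<infinity>m. f r m) = F r" for r
  proof -
    have "summable (\<lambda>m. norm (f r m))"
      using summable_comparison_test'[OF sums_summable[OF g[of r]], of 0 "\<lambda>m. norm (f r m)"] le by auto
    then show ?thesis using norm_summable_imp_has_sum[OF _ f[of r]] by (simp add: infsumI)
  qed
  have si: "(\<lambda>m. \<Sum>\<^sub>\<infinity>r. f r m) summable_on UNIV"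
    using summable_on_Sigma_banach[OF sf'] by simp
  then have "(\<lambda>m. \<Sum>r. f r m) summable_on UNIV" by (simp add: eq)
  \<comment> \<open>Unordered summability of reals is absolute summability, which yields the
    absolute convergence of the column sums.\<close>
  then have "(\<lambda>m. \<bar>\<Sum>r. f r m\<bar>) summable_on UNIV"
    using summable_on_iff_abs_summable_on_real[of "\<lambda>m. \<Sum>r. f r m" UNIV] by simp
  then show "summable (\<lambda>m. \<bar>\<Sum>r. f r m\<bar>)" by (rule summable_on_imp_summable)
  have "(\<Sum>\<^sub>\<infinity>m. \<Sum>\<^sub>\<infinity>r. f r m) = (\<Sum>\<^sub>\<infinity>r. \<Sum>\<^sub>\<infinity>m. f r m)"
    using infsum_swap_banach[OF sf] by simp
  also have "\<dots> = (\<Sum>\<^sub>\<infinity>r. F r)" by (simp add: eqF)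
  also have "\<dots> = (\<Sum>r. F r)"
  proof -
    have "F summable_on UNIV"
      using summable_on_Sigma_banach[OF sf] by (simp add: eqF)
    from has_sum_imp_sums[OF has_sum_infsum[OF this]] show ?thesis by (simp add: sums_iff)
  qed
  finally show "(\<lambda>m. \<Sum>r. f r m) sums (\<Sum>r. F r)"
    using has_sum_imp_sums[OF has_sum_infsum[OF si]] by (simp add: eq)
qed

section \<open>The expansion of exp (x (1 + w)^\<delta>) in powers of w and its continuation\<close>

lemma exp_series_sums: "(\<lambda>r. x ^ r / fact r) sums exp (x::real)"
  using exp_converges[of x] by (simp add: field_simps)

text \<open>Expand the exponential in powers of x (1 + w)^\<delta>, then each (1 + w)^(r \<delta>)
  by the binomial series, and collect powers of w. The interchange is absolute because the majorants
  of the inner series are r-th powers of one number \<open>y\<close>, so that they add up to exp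
  (|x| y).\<close>

lemma exp_powr_coeff:
  fixes x \<delta> w :: real
  defines "c \<equiv> \<lambda>m. \<Sum>r. x ^ r / fact r * (real r * \<delta> gchoose m)"
  assumes "\<delta> > 0" "w \<ge> 0" and w: "w < 1 \<or> \<delta> \<in> \<nat>"
  shows "\<And>m. w > 0 \<Longrightarrow> summable (\<lambda>r. x ^ r / fact r * (real r * \<delta> gchoose m))"
    and "summable (\<lambda>m. \<bar>c m * w ^ m\<bar>)"
    and "(\<lambda>m. c m * w ^ m) sums exp (x * (1 + w) powr \<delta>)"
proof -
  \<comment> \<open>For integer \<delta> the coefficients are nonnegative and majorize themselves
    for every \<open>w\<close>; otherwise the coefficients of (1 - w)^(-r \<delta>) serve, which
    requires \<open>w < 1\<close>.\<close>
  define h where "h = (\<lambda>r m. if \<delta> \<in> \<nat> then \<bar>real r * \<delta> gchoose m\<bar> * w ^ m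
                       else (-1) ^ m * (- (real r * \<delta>) gchoose m) * w ^ m)"
  define y where "y = (if \<delta> \<in> \<nat> then (1 + w) powr \<delta> else (1 - w) powr (- \<delta>))"
  define f where "f = (\<lambda>r m. x ^ r / fact r * (real r * \<delta> gchoose m) * w ^ m)"
  have powr_pow: "b powr (real r * d) = (b powr d) ^ r" if "b > 0" for b d :: real and r
    using that by (simp add: powr_powr[symmetric] powr_realpow mult.commute)
  have f_sums: "(\<lambda>m. (real r * \<delta> gchoose m) * w ^ m) sums ((1 + w) powr \<delta>) ^ r" for r
  proof (cases "\<delta> \<in> \<nat>")
    case True
    then obtain d where d: "\<delta> = real d" by (auto elim: Nats_cases)
    have "(\<lambda>m. (real (r * d) gchoose m) * w ^ m) sums (1 + w) ^ (r * d)"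
      using assms by (intro gbinomial_nat_power_sums)
    moreover have "(1 + w) ^ (r * d) = ((1 + w) powr \<delta>) ^ r"
      using assms by (simp add: d powr_realpow power_mult[symmetric] mult.commute)
    ultimately show ?thesis by (simp add: d)
  next
    case False
    then have "(\<lambda>m. (real r * \<delta> gchoose m) * w ^ m) sums (1 + w) powr (real r * \<delta>)"
      using assms by (intro gen_binomial_real) auto
    then show ?thesis using assms by (simp add: powr_pow)
  qed
  have h_sums: "h r sums y ^ r" for r
  proof (cases "\<delta> \<in> \<nat>")
    case True
    then obtain d where d: "\<delta> = real d" by (auto elim: Nats_cases)
    have "\<bar>real r * \<delta> gchoose m\<bar> = (real r * \<delta> gchoose m)" for m
    proof -
      have "(real r * \<delta> gchoose m) = real ((r * d) choose m)"
        by (simp add: d binomial_gbinomial)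
      then show ?thesis by simp
    qed
    then show ?thesis using True f_sums[of r] by (simp add: h_def y_def)
  next
    case False
    then have "h r sums (1 - w) powr (- (real r * \<delta>))"
      unfolding h_def using assms binomial_majorant_sums[of w "real r * \<delta>"] by simp
    then show ?thesis
      using False assms powr_pow[of "1 - w" r "- \<delta>"] by (simp add: y_def)
  qed
  have le: "\<bar>f r m\<bar> \<le> \<bar>x\<bar> ^ r / fact r * h r m" for r m
    using abs_gbinomial_le[of "real r * \<delta>" m] assms
    unfolding f_def h_def abs_mult mult.assoc[of "_ / _"]
    by (intro mult_mono) (auto simp: abs_mult power_abs intro: mult_right_mono)
  have g: "(\<lambda>m. \<bar>x\<bar> ^ r / fact r * h r m) sums (\<bar>x\<bar> ^ r / fact r * y ^ r)" for r
    by (intro sums_mult h_sums)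
  have G: "summable (\<lambda>r. \<bar>x\<bar> ^ r / fact r * y ^ r)"
    using exp_series_sums[of "\<bar>x\<bar> * y"] by (simp add: sums_iff power_mult_distrib)
  have F: "f r sums (x ^ r / fact r * ((1 + w) powr \<delta>) ^ r)" for r
    unfolding f_def using sums_mult[OF f_sums[of r], of "x ^ r / fact r"] by (simp only: mult.assoc)
  note swap = double_series_swap[OF le g G F]
  \<comment> \<open>The series is free of \<open>w\<close>; a positive \<open>w\<close> is used only
    to divide out \<open>w ^ m\<close>.\<close>
  show sm: "summable (\<lambda>r. x ^ r / fact r * (real r * \<delta> gchoose m))" if "w > 0" for m
    using summable_mult2[OF swap(1)[of m], of "1 / w ^ m"] that by (simp add: f_def)
  have c: "c m * w ^ m = (\<Sum>r. f r m)" for m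
  \<comment> \<open>At \<open>w = 0\<close> every term with \<open>m > 0\<close> vanishes on both
    sides, and for \<open>m = 0\<close> the series is the exponential series.\<close>
  proof (cases "w = 0 \<and> m > 0")
    case False
    then have "summable (\<lambda>r. x ^ r / fact r * (real r * \<delta> gchoose m))"
    proof (cases "w = 0")
      case True
      then show ?thesis using False exp_series_sums[of x] by (simp add: sums_iff)
    qed (use sm assms in auto)
    then show ?thesis unfolding c_def f_def by (rule suminf_mult2)
  qed (simp add: f_def zero_power)
  show "summable (\<lambda>m. \<bar>c m * w ^ m\<bar>)" using swap(2) by (simp add: c)
  have "(\<Sum>r. x ^ r / fact r * ((1 + w) powr \<delta>) ^ r) = exp (x * (1 + w) powr \<delta>)"
    using exp_series_sums[of "x * (1 + w) powr \<delta>"] by (simp add: sums_iff power_mult_distrib)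
  then show "(\<lambda>m. c m * w ^ m) sums exp (x * (1 + w) powr \<delta>)" using swap(3) by (simp add: c)
qed

text \<open>Both sides are holomorphic in a complex variable and agree on a real interval that
  accumulates at 0, so the identity theorem carries the expansion past the radius 1 of the binomial
  series.\<close>

lemma exp_powr_series_continuation:
  fixes x \<delta> z w :: real and c :: "nat \<Rightarrow> real"
  assumes near0: "\<And>w. 0 \<le> w \<Longrightarrow> w < 1 \<Longrightarrow> (\<lambda>m. c m * w ^ m) sums exp (x * (1 + w) powr \<delta>)"
    and summ: "\<And>w. 0 \<le> w \<Longrightarrow> w < z \<Longrightarrow> summable (\<lambda>m. \<bar>c m * w ^ m\<bar>)"
    and w: "0 \<le> w" "w < z"
  shows "(\<lambda>m. c m * w ^ m) sums exp (x * (1 + w) powr \<delta>)"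
proof -
  define S where "S = (\<lambda>u::complex. \<Sum>m. of_real (c m) * u ^ m)"
  \<comment> \<open>The half-plane keeps 1 + u off the branch cut of the complex power; the
    intersection is convex, hence connected, and contains the real points of [0, z).\<close>
  define D where "D = ball (0::complex) z \<inter> {u. Re u > -1}"
  have S: "(\<lambda>m. of_real (c m) * u ^ m) sums S u" if "norm u < z" for u :: complex
  proof -
    have "summable (\<lambda>m. norm (of_real (c m) * u ^ m))"
      using summ[of "norm u"] that by (simp add: norm_mult norm_power abs_mult)
    then show ?thesis unfolding S_def by (rule summable_sums[OF summable_norm_cancel])
  qed
  have S_real: "(\<lambda>m. c m * v ^ m) sums Re (S (of_real v))" if "0 \<le> v" "v < z" for v
    using sums_Re[OF S[of "of_real v"]] that by (simp flip: of_real_power of_real_mult)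
  have S_of_real: "S (of_real v) = of_real (\<Sum>m. c m * v ^ m)" if "0 \<le> v" "v < z" for v
    using that summable_rabs_cancel[OF summ[of v]]
    unfolding S_def by (simp flip: of_real_power of_real_mult add: suminf_of_real)
  have "(\<lambda>u. S u - exp (of_real x * (1 + u) powr of_real \<delta>)) (of_real w) = 0"
  proof (rule analytic_continuation[where S = D and U = "of_real ` {0<..<min 1 z}" and \<xi> = 0
          and f = "\<lambda>u. S u - exp (of_real x * (1 + u) powr of_real \<delta>)"])
    have "S holomorphic_on ball 0 z"
      by (rule power_series_holomorphic[where a = "\<lambda>m. of_real (c m)"]) (use S in auto)
    then have "S holomorphic_on D" by (rule holomorphic_on_subset) (auto simp: D_def)
    then show "(\<lambda>u. S u - exp (of_real x * (1 + u) powr of_real \<delta>)) holomorphic_on D"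
      by (intro holomorphic_intros) (auto simp: D_def complex_nonpos_Reals_iff)
    show "open D" unfolding D_def by (intro open_Int open_ball open_halfspace_Re_gt)
    show "connected D" unfolding D_def
      by (intro convex_connected convex_Int convex_ball convex_halfspace_Re_gt)
    show "of_real ` {0<..<min 1 z} \<subseteq> D" by (auto simp: D_def)
    show "0 \<in> D" "of_real w \<in> D" using w by (auto simp: D_def)
    show "(0::complex) islimpt of_real ` {0<..<min 1 z}"
      unfolding islimpt_approachable
    proof (intro allI impI)
      fix e :: real assume "e > 0"
      define v where "v = min e (min 1 z) / 2"
      have "v > 0" "v < e" "v < min 1 z" using \<open>e > 0\<close> w by (auto simp: v_def min_def)
      then show "\<exists>x'\<in>of_real ` {0<..<min 1 z}. x' \<noteq> (0::complex) \<and> dist x' 0 < e"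
        by (intro bexI[of _ "of_real v"]) auto
    qed
    fix u :: complex assume "u \<in> of_real ` {0<..<min 1 z}"
    then obtain v where v: "u = of_real v" "0 < v" "v < 1" "v < z" by auto
    have "S u = of_real (exp (x * (1 + v) powr \<delta>))"
      using S_of_real[of v] near0[of v] v by (simp add: sums_iff)
    also have "\<dots> = exp (of_real x * (1 + u) powr of_real \<delta>)"
      using v powr_of_real[of "1 + v" \<delta>] by (simp flip: exp_of_real)
    finally show "S u - exp (of_real x * (1 + u) powr of_real \<delta>) = 0" by simp
  qed
  then have "S (of_real w) = of_real (exp (x * (1 + w) powr \<delta>))"
    using w powr_of_real[of "1 + w" \<delta>] by (simp flip: exp_of_real)
  then show ?thesis using S_real[OF w] by simp
qed

section \<open>Uniqueness of coefficients and Abel's limit theorem\<close>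

text \<open>The sums are known only to the right of 0. The difference series still converges on both
  sides, and a nonzero power series vanishing at 0 has an isolated zero there, which contradicts its
  vanishing on a right neighbourhood.\<close>

lemma power_series_coeffs_unique:
  fixes a b :: "nat \<Rightarrow> real"
  assumes "\<epsilon> > 0"
    and "\<And>s. 0 \<le> s \<Longrightarrow> s < \<epsilon> \<Longrightarrow> (\<lambda>k. a k * s ^ k) sums f s"
    and "\<And>s. 0 \<le> s \<Longrightarrow> s < \<epsilon> \<Longrightarrow> (\<lambda>k. b k * s ^ k) sums f s"
  shows "a = b"
proof (rule ccontr)
  define d where "d = (\<lambda>k. a k - b k)"
  have d0: "(\<lambda>k. d k * s ^ k) sums 0" if "0 \<le> s" "s < \<epsilon>" for s
    using sums_diff[OF assms(2)[OF that] assms(3)[OF that]] by (simp add: d_def algebra_simps)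
  assume "a \<noteq> b"
  then obtain k where k: "d k \<noteq> 0" by (auto simp: d_def fun_eq_iff)
  have "d 0 = 0" using sums_unique[OF d0[of 0]] \<open>\<epsilon> > 0\<close> by simp
  then have "k > 0" using k by (cases k) auto
  \<comment> \<open>Convergence at the single point \<epsilon> / 2 gives convergence at all points
    of smaller modulus, negative ones included.\<close>
  have "summable (\<lambda>k. d k * x ^ k)" if "norm (x - 0) < \<epsilon> / 2" for x
    by (rule powser_inside[of _ "\<epsilon> / 2"]) (use d0[of "\<epsilon> / 2"] \<open>\<epsilon> > 0\<close> that in \<open>auto simp: sums_iff\<close>)
  then have "(\<lambda>k. d k * (x - 0) ^ k) sums (\<Sum>k. d k * x ^ k)" if "norm (x - 0) < \<epsilon> / 2" for x
    using that by (auto intro: summable_sums)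
  then obtain s where s: "s > 0" "\<And>z. z \<in> cball 0 s - {0} \<Longrightarrow> (\<Sum>k. d k * z ^ k) \<noteq> 0"
    using powser_0_nonzero[of "\<epsilon> / 2" 0 d "\<lambda>x. \<Sum>k. d k * x ^ k" k] k \<open>k > 0\<close> \<open>\<epsilon> > 0\<close> \<open>d 0 = 0\<close>
    by auto
  define v where "v = min s (\<epsilon> / 2)"
  have "(\<Sum>k. d k * v ^ k) = 0" using d0[of v] s(1) \<open>\<epsilon> > 0\<close> by (auto simp: v_def sums_iff min_def)
  moreover have "(\<Sum>k. d k * v ^ k) \<noteq> 0" using s \<open>\<epsilon> > 0\<close> by (intro s(2)) (auto simp: v_def)
  ultimately show False by simp
qed

text \<open>Summation by parts with the tails \<open>r m\<close> expresses the difference from the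
  limit as (1 - \<rho>) times a power series in the tails. Early tails are bounded and damped by 1 -
  \<rho>; late tails are small, and the geometric sum cancels 1 - \<rho>.\<close>

theorem Abel_limit:
  fixes a :: "nat \<Rightarrow> real"
  assumes "summable a"
  shows "((\<lambda>\<rho>. \<Sum>m. a m * \<rho> ^ m) \<longlongrightarrow> suminf a) (at_left 1)"
proof -
  define r where "r = (\<lambda>m. \<Sum>j. a (j + m))"
  have "r \<longlonglongrightarrow> 0"
    using suminf_exist_split2[OF assms] by (simp add: r_def)
  then have Br: "Bseq r" by (intro convergent_imp_Bseq) (auto simp: convergent_def)
  have r_step: "r m - r (Suc m) = a m" for m
    using suminf_split_initial_segment[of "\<lambda>j. a (j + m)" 1] assms
    by (simp add: r_def summable_ignore_initial_segment add_ac)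
  obtain B where B: "B > 0" "\<And>m. \<bar>r m\<bar> \<le> B" using Br by (auto simp: Bseq_def)
  have sr: "summable (\<lambda>m. \<bar>r (Suc m)\<bar> * \<rho> ^ m)" if "0 \<le> \<rho>" "\<rho> < 1" for \<rho>
    by (rule summable_comparison_test'[of "\<lambda>m. B * \<rho> ^ m" 0])
       (use that B in \<open>auto intro!: summable_mult summable_geometric mult_right_mono\<close>)
  have key: "(\<Sum>m. a m * \<rho> ^ m) = suminf a - (1 - \<rho>) * (\<Sum>m. r (Suc m) * \<rho> ^ m)"
    if "0 < \<rho>" "\<rho> < 1" for \<rho>
  proof -
    have s1: "summable (\<lambda>m. r (Suc m) * \<rho> ^ m)"
      using sr[of \<rho>] that by (rule_tac summable_rabs_cancel) (simp add: abs_mult)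
    have s2: "summable (\<lambda>m. r m * \<rho> ^ m)"
    proof -
      have "summable (\<lambda>m. r (Suc m) * \<rho> ^ m * \<rho>)" using s1 by (rule summable_mult2)
      then have "summable (\<lambda>m. r (Suc m) * \<rho> ^ Suc m)" by (simp add: mult_ac)
      then show ?thesis using summable_Suc_iff[of "\<lambda>m. r m * \<rho> ^ m"] by simp
    qed
    have "(\<Sum>m. a m * \<rho> ^ m) = (\<Sum>m. r m * \<rho> ^ m - r (Suc m) * \<rho> ^ m)"
      by (simp add: r_step[symmetric] algebra_simps)
    also have "\<dots> = (\<Sum>m. r m * \<rho> ^ m) - (\<Sum>m. r (Suc m) * \<rho> ^ m)"
      by (rule suminf_diff[symmetric, OF s2 s1])
    also have "(\<Sum>m. r m * \<rho> ^ m) = r 0 + (\<Sum>m. r (Suc m) * \<rho> ^ m * \<rho>)"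
      using suminf_split_head[OF s2] by (simp add: mult_ac)
    also have "(\<Sum>m. r (Suc m) * \<rho> ^ m * \<rho>) = (\<Sum>m. r (Suc m) * \<rho> ^ m) * \<rho>"
      using suminf_mult2[OF s1] by simp
    finally show ?thesis by (simp add: algebra_simps r_def)
  qed
  have "((\<lambda>\<rho>. (1 - \<rho>) * (\<Sum>m. r (Suc m) * \<rho> ^ m)) \<longlongrightarrow> 0) (at_left 1)"
  proof (rule tendstoI)
    fix e :: real assume "e > 0"
    then obtain M where M: "\<And>m. m \<ge> M \<Longrightarrow> \<bar>r m\<bar> < e / 2"
      using \<open>r \<longlonglongrightarrow> 0\<close> half_gt_zero[OF \<open>e > 0\<close>] unfolding LIMSEQ_iff
      by (metis diff_zero real_norm_def)
    \<comment> \<open>\<open>B * real M\<close> bounds the contribution of the first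
      \<open>M\<close> tails; the extra 1 makes \<open>K\<close> positive, so that \<rho> can be
      taken with (1 - \<rho>) K < e / 2.\<close>
    define K where "K = B * real M + 1"
    have "K > 0" using B by (simp add: K_def add_nonneg_pos)
    have "eventually (\<lambda>\<rho>::real. \<rho> \<in> {max 0 (1 - e / (2 * K))<..<1}) (at_left 1)"
      using \<open>e > 0\<close> \<open>K > 0\<close> by (intro eventually_at_left_real) auto
    then show "eventually (\<lambda>\<rho>. dist ((1 - \<rho>) * (\<Sum>m. r (Suc m) * \<rho> ^ m)) 0 < e) (at_left 1)"
    proof eventually_elim
      case (elim \<rho>)
      then have \<rho>: "0 < \<rho>" "\<rho> < 1" "(1 - \<rho>) * K < e / 2"
        using \<open>K > 0\<close> by (auto simp: field_simps)
      have abs_sum: "\<bar>\<Sum>m. r (Suc m) * \<rho> ^ m\<bar> \<le> (\<Sum>m. \<bar>r (Suc m)\<bar> * \<rho> ^ m)"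
        using summable_rabs[of "\<lambda>m. r (Suc m) * \<rho> ^ m"] sr[of \<rho>] \<rho> by (simp add: abs_mult)
      also have "\<dots> \<le> (\<Sum>m. (if m < M then B else 0) + e / 2 * \<rho> ^ m)"
      proof (rule suminf_le)
        show "\<bar>r (Suc m)\<bar> * \<rho> ^ m \<le> (if m < M then B else 0) + e / 2 * \<rho> ^ m" for m
        proof (cases "m < M")
          case True
          have "\<bar>r (Suc m)\<bar> * \<rho> ^ m \<le> B * 1"
            using B \<rho> by (intro mult_mono power_le_one) auto
          moreover have "e / 2 * \<rho> ^ m \<ge> 0" using \<open>e > 0\<close> \<rho> by simp
          ultimately show ?thesis using True by simp
        next
          case False
          then show ?thesis using M[of "Suc m"] \<rho> by (auto intro!: mult_right_mono)
        qed
        show "summable (\<lambda>m. (if m < M then B else 0) + e / 2 * \<rho> ^ m)"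
          using \<rho> by (intro summable_add summable_mult summable_geometric
              summable_finite[of "{..<M}"]) auto
      qed (use sr \<rho> in auto)
      also have "\<dots> = B * real M + e / 2 * (1 / (1 - \<rho>))"
      proof -
        have "(\<lambda>m. if m < M then B else 0) sums (\<Sum>m<M. if m < M then B else 0)"
          by (rule sums_finite) auto
        moreover have "(\<lambda>m. e / 2 * \<rho> ^ m) sums (e / 2 * (1 / (1 - \<rho>)))"
          using \<rho> by (intro sums_mult geometric_sums) auto
        ultimately have "(\<lambda>m. (if m < M then B else 0) + e / 2 * \<rho> ^ m) sums
            ((\<Sum>m<M. if m < M then B else 0) + e / 2 * (1 / (1 - \<rho>)))"
          by (rule sums_add)
        then show ?thesis by (simp add: sums_iff mult.commute)
      qed
      finally have "(1 - \<rho>) * \<bar>\<Sum>m. r (Suc m) * \<rho> ^ m\<bar>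
          \<le> (1 - \<rho>) * (B * real M + e / 2 * (1 / (1 - \<rho>)))"
        using \<rho> by (intro mult_left_mono) auto
      also have "\<dots> = (1 - \<rho>) * (B * real M) + e / 2" using \<rho> by (simp add: field_simps)
      also have "\<dots> \<le> (1 - \<rho>) * K + e / 2"
        using \<rho> by (auto simp: K_def intro!: mult_left_mono)
      also have "\<dots> < e" using \<rho> by simp
      finally show ?case using \<rho> by (simp add: abs_mult)
    qed
  qed
  then have "((\<lambda>\<rho>. suminf a - (1 - \<rho>) * (\<Sum>m. r (Suc m) * \<rho> ^ m)) \<longlongrightarrow> suminf a - 0) (at_left 1)"
    by (intro tendsto_intros)
  moreover have "eventually (\<lambda>\<rho>::real. \<rho> \<in> {0<..<1}) (at_left 1)"
    by (intro eventually_at_left_real) auto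
  then have "eventually (\<lambda>\<rho>. suminf a - (1 - \<rho>) * (\<Sum>m. r (Suc m) * \<rho> ^ m) = (\<Sum>m. a m * \<rho> ^ m)) (at_left 1)"
    by eventually_elim (simp add: key)
  ultimately show ?thesis by (simp add: tendsto_cong)
qed

subsection \<open>Series expansion of the state probabilities\<close>

text \<open>Each (1 - s)^(\<nu> m) is expanded in powers of s. Its majorant is (1 - s)^(-\<nu> m),
  so the interchange costs absolute convergence of the series for \<open>G\<close> at the enlarged
  argument w (1 - s)^(-\<nu>), which \<open>y\<close> bounds for all s up to
  \<open>s\<^sub>0\<close>.\<close>

lemma binomial_expansion_swap:
  fixes c :: "nat \<Rightarrow> real"
  assumes c: "summable (\<lambda>m. \<bar>c m * y ^ m\<bar>)"
    and G: "\<And>v. 0 \<le> v \<Longrightarrow> v \<le> y \<Longrightarrow> (\<lambda>m. c m * v ^ m) sums G v"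
    and "\<nu> > 0" "w \<ge> 0" "0 < s\<^sub>0" "s\<^sub>0 < 1" "w * (1 - s\<^sub>0) powr (- \<nu>) \<le> y"
  shows "\<And>k. summable (\<lambda>m. c m * w ^ m * (\<nu> * real m gchoose k))"
    and "\<And>s. 0 \<le> s \<Longrightarrow> s \<le> s\<^sub>0 \<Longrightarrow>
      (\<lambda>k. (-1) ^ k * (\<Sum>m. c m * w ^ m * (\<nu> * real m gchoose k)) * s ^ k) sums G (w * (1 - s) powr \<nu>)"
proof -
  define f where "f = (\<lambda>s m k. c m * w ^ m * ((\<nu> * real m gchoose k) * (- s) ^ k))"
  have pow: "b powr (a * real m) = (b powr a) ^ m" if "b > 0" for a b :: real and m
    using that by (simp add: powr_powr[symmetric] powr_realpow)
  have swap: "summable (\<lambda>m. f s m k)" "(\<lambda>k. \<Sum>m. f s m k) sums G (w * (1 - s) powr \<nu>)"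
    if s: "0 \<le> s" "s \<le> s\<^sub>0" for s k
  proof -
    define g where "g = (\<lambda>m k. \<bar>c m * w ^ m\<bar> * ((-1) ^ k * (- (\<nu> * real m) gchoose k) * s ^ k))"
    have s1: "s < 1" using s assms by simp
    have le: "\<bar>f s m k\<bar> \<le> g m k" for m k
      using abs_gbinomial_le[of "\<nu> * real m" k] assms s unfolding f_def g_def abs_mult
      by (intro mult_left_mono) (auto simp: power_abs intro!: mult_right_mono)
    have g: "g m sums (\<bar>c m\<bar> * (w * (1 - s) powr (- \<nu>)) ^ m)" for m
      using sums_mult[OF binomial_majorant_sums[OF s(1) s1, of "\<nu> * real m"], of "\<bar>c m * w ^ m\<bar>"]
        pow[of "1 - s" "- \<nu>" m] s1 assms
      by (simp add: g_def abs_mult power_mult_distrib mult_ac)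
    have "w * (1 - s) powr (- \<nu>) \<le> w * (1 - s\<^sub>0) powr (- \<nu>)"
      using assms s by (intro mult_left_mono powr_mono2') auto
    then have "w * (1 - s) powr (- \<nu>) \<le> y" using assms by linarith
    then have "norm (\<bar>c m\<bar> * (w * (1 - s) powr (- \<nu>)) ^ m) \<le> \<bar>c m * y ^ m\<bar>" for m
      using assms by (auto simp: abs_mult power_abs intro!: mult_left_mono power_mono)
    then have Gs: "summable (\<lambda>m. \<bar>c m\<bar> * (w * (1 - s) powr (- \<nu>)) ^ m)"
      by (intro summable_comparison_test'[OF c, of 0]) auto
    have F: "f s m sums (c m * (w * (1 - s) powr \<nu>) ^ m)" for m
    proof -
      have "(\<lambda>k. (\<nu> * real m gchoose k) * (- s) ^ k) sums (1 + (- s)) powr (\<nu> * real m)"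
        using s s1 by (intro gen_binomial_real) auto
      from sums_mult[OF this, of "c m * w ^ m"] show ?thesis
        using pow[of "1 - s" \<nu> m] s1 by (simp add: f_def power_mult_distrib mult_ac)
    qed
    note sw = double_series_swap[OF le g Gs F]
    show "summable (\<lambda>m. f s m k)" by (rule sw(1))
    \<comment> \<open>The argument at which \<open>G\<close> is evaluated must also lie below
      \<open>y\<close>; the two powers are separated by 1.\<close>
    have "w * (1 - s) powr \<nu> \<le> w * (1 - s\<^sub>0) powr (- \<nu>)"
    proof -
      have "(1 - s) powr \<nu> \<le> 1" using powr_mono2[of \<nu> "1 - s" 1] s s1 assms by simp
      also have "1 \<le> (1 - s\<^sub>0) powr (- \<nu>)"
        using powr_mono2'[of "- \<nu>" "1 - s\<^sub>0" 1] assms by simp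
      finally show ?thesis using assms by (intro mult_left_mono) auto
    qed
    then have "(\<lambda>m. c m * (w * (1 - s) powr \<nu>) ^ m) sums G (w * (1 - s) powr \<nu>)"
      using assms by (intro G) auto
    then show "(\<lambda>k. \<Sum>m. f s m k) sums G (w * (1 - s) powr \<nu>)"
      using sw(3) by (simp add: sums_iff)
  qed
  show sm: "summable (\<lambda>m. c m * w ^ m * (\<nu> * real m gchoose k))" for k
  proof -
    \<comment> \<open>The point \<open>s\<^sub>0\<close> is nonzero, so its k-th power can be
      divided out.\<close>
    have "summable (\<lambda>m. f s\<^sub>0 m k * (1 / (- s\<^sub>0) ^ k))"
      using assms by (intro summable_mult2 swap) auto
    then show ?thesis using assms by (simp add: f_def mult.assoc)
  qed
  fix s assume s: "0 \<le> s" "s \<le> s\<^sub>0"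
  have "(\<Sum>m. f s m k) = (-1) ^ k * (\<Sum>m. c m * w ^ m * (\<nu> * real m gchoose k)) * s ^ k" for k
    using suminf_mult2[OF sm[of k], of "(- s) ^ k"]
    by (simp add: f_def power_minus[of s] mult_ac)
  then show "(\<lambda>k. (-1) ^ k * (\<Sum>m. c m * w ^ m * (\<nu> * real m gchoose k)) * s ^ k)
      sums G (w * (1 - s) powr \<nu>)"
    using swap(2)[OF s] by simp
qed

text \<open>Once \<nu> m \<ge> k, all k factors \<nu> m - i are at least 1. Convergence of a series
  weighted by these coefficients can therefore be passed to the unweighted one.\<close>

lemma gbinomial_abs_bounded_below:
  assumes "\<nu> > (0::real)"
  shows "eventually (\<lambda>m. \<bar>\<nu> * real m gchoose k\<bar> \<ge> 1 / fact k) sequentially"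
proof -
  have "eventually (\<lambda>m. real k / \<nu> \<le> real m) sequentially"
    using filterlim_real_sequentially by (simp add: filterlim_at_top)
  then show ?thesis
  proof eventually_elim
    case (elim m)
    then have "real k \<le> \<nu> * real m" using assms by (simp add: field_simps)
    then have "(\<Prod>i<k. \<nu> * real m - real i) \<ge> 1"
      by (intro prod_ge_1) fastforce
    then have "1 / fact k \<le> (\<nu> * real m gchoose k)"
      by (simp add: gbinomial_prod_rev atLeast0LessThan divide_right_mono)
    then show ?case by linarith
  qed
qed

section \<open>The state series in the normalized variable x^\<nu> / \<eta>\<close>

context
  fixes t \<delta> \<eta> \<nu> :: real and c :: "nat \<Rightarrow> real"
  assumes pos: "\<delta> > 0" "\<eta> > 0" "\<nu> > 0"
  defines "c \<equiv> \<lambda>m. \<Sum>r. (- t * \<eta> powr \<delta>) ^ r / fact r * (real r * \<delta> gchoose m)"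
begin

lemma coefficient_series:
  assumes "w \<ge> 0" "w < 1 \<or> \<delta> \<in> \<nat>"
  shows "summable (\<lambda>m. \<bar>c m * w ^ m\<bar>)"
    and "(\<lambda>m. c m * w ^ m) sums exp (- t * \<eta> powr \<delta> * (1 + w) powr \<delta>)"
  unfolding c_def using pos assms by (intro exp_powr_coeff; simp)+

text \<open>The interchange needs absolute convergence slightly beyond \<open>z\<close>, and the
  expansion of the exponential converges there too: up to 1 in general, everywhere for integer
  \<delta>.\<close>

lemma state_series_summable:
  assumes "z > 0" "z < 1 \<or> \<delta> \<in> \<nat>"
  shows "summable (\<lambda>m. c m * z ^ m * (\<nu> * real m gchoose k))"
proof -
  obtain y where y: "z < y" "y < 1 \<or> \<delta> \<in> \<nat>"
    using assms dense[of z 1] by (metis gt_ex)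
  \<comment> \<open>The solution of z (1 - s)^(-\<nu>) = y.\<close>
  define s where "s = 1 - (z / y) powr (1 / \<nu>)"
  have "0 < (z / y) powr (1 / \<nu>)" using assms y by simp
  moreover have "(z / y) powr (1 / \<nu>) < 1 powr (1 / \<nu>)"
    using assms y pos by (intro powr_less_mono2) auto
  ultimately have s: "0 < s" "s < 1" by (auto simp: s_def)
  have "z * (1 - s) powr (- \<nu>) \<le> y"
    using assms y pos by (simp add: s_def powr_powr powr_minus)
  show ?thesis
    by (rule binomial_expansion_swap(1)[where y = y and s\<^sub>0 = s
          and G = "\<lambda>v. exp (- t * \<eta> powr \<delta> * (1 + v) powr \<delta>)"])
       (use assms y s pos \<open>z * (1 - s) powr (- \<nu>) \<le> y\<close> coefficient_series in auto)
qed

text \<open>Convergence of the state series at the given rate forces convergence of the expansion at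
  all smaller rates. Comparing coefficients of s^k gives the formula there, and left continuity
  together with Abel's theorem transfers it to the rate itself.\<close>

lemma generating_function_coefficient:
  fixes q :: "nat \<Rightarrow> real \<Rightarrow> real"
  assumes "rate > 0"
    and gen: "\<And>x s. 0 < x \<Longrightarrow> 0 \<le> s \<Longrightarrow> s < 1 \<Longrightarrow> (\<lambda>k. q k x * s ^ k) sums
        (exp (t * \<eta> powr \<delta>) * exp (- t * (\<eta> + (x * (1 - s)) powr \<nu>) powr \<delta>))"
    and cont: "(q k \<longlongrightarrow> q k rate) (at_left rate)"
    and summ: "summable (\<lambda>m. c m * (rate powr \<nu> / \<eta>) ^ m * (\<nu> * real m gchoose k))"
  shows "q k rate = exp (t * \<eta> powr \<delta>) * ((-1) ^ k *
           (\<Sum>m. c m * (rate powr \<nu> / \<eta>) ^ m * (\<nu> * real m gchoose k)))"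
proof -
  define z where "z = rate powr \<nu> / \<eta>"
  have "z > 0" using assms pos by (simp add: z_def)
  define G where "G = (\<lambda>v. exp (- t * \<eta> powr \<delta> * (1 + v) powr \<delta>))"
  \<comment> \<open>The weighted series converges at \<open>z\<close>, hence absolutely at
    \<open>v\<close>; the lower bound on the binomial coefficients then removes the weight.\<close>
  have abs_summ: "summable (\<lambda>m. \<bar>c m * v ^ m\<bar>)" if v: "0 \<le> v" "v < z" for v
  proof -
    have "summable (\<lambda>m. norm ((c m * (\<nu> * real m gchoose k)) * v ^ m))"
      by (rule powser_insidea[of _ z]) (use summ v \<open>z > 0\<close> in \<open>auto simp: z_def[symmetric] mult_ac\<close>)
    then have "summable (\<lambda>m. fact k * norm ((c m * (\<nu> * real m gchoose k)) * v ^ m))"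
      by (rule summable_mult)
    moreover have "eventually (\<lambda>m. norm \<bar>c m * v ^ m\<bar> \<le>
        fact k * norm ((c m * (\<nu> * real m gchoose k)) * v ^ m)) sequentially"
      using gbinomial_abs_bounded_below[OF pos(3), of k]
    proof eventually_elim
      case (elim m)
      have "\<bar>c m * v ^ m\<bar> * 1 \<le> \<bar>c m * v ^ m\<bar> * (fact k * \<bar>\<nu> * real m gchoose k\<bar>)"
        using elim by (intro mult_left_mono) (auto simp: field_simps)
      then show ?case by (simp add: abs_mult mult_ac)
    qed
    ultimately show ?thesis by (rule_tac summable_comparison_test_ev)
  qed
  have G: "(\<lambda>m. c m * v ^ m) sums G v" if "0 \<le> v" "v < z" for v
    unfolding G_def
    by (rule exp_powr_series_continuation[of c _ _ z])
       (use pos that abs_summ coefficient_series(2) in auto)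
  have eq: "q k x = exp (t * \<eta> powr \<delta>) * ((-1) ^ k *
      (\<Sum>m. c m * z ^ m * (\<nu> * real m gchoose k) * ((x / rate) powr \<nu>) ^ m))"
    if x: "0 < x" "x < rate" for x
  proof -
    \<comment> \<open>Half the gap: 1 - s is the mean of 1 and x / rate, so x / (1 - s) remains
      below \<open>rate\<close>.\<close>
    define s where "s = (1 - x / rate) / 2"
    have s: "0 < s" "s < 1" "x / (1 - s) < rate"
      using x by (auto simp: s_def field_simps)
    define w where "w = x powr \<nu> / \<eta>"
    define y where "y = (x / (1 - s)) powr \<nu> / \<eta>"
    have "y < z" unfolding y_def z_def
      using s x pos by (intro divide_strict_right_mono powr_less_mono2) auto
    have wy: "w * (1 - s) powr (- \<nu>) \<le> y"
      using s x by (simp add: w_def y_def powr_divide powr_minus field_simps)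
    have y0: "y \<ge> 0" using pos by (simp add: y_def)
    have w0: "w \<ge> 0" using pos by (simp add: w_def)
    have G': "(\<lambda>m. c m * v ^ m) sums G v" if "0 \<le> v" "v \<le> y" for v
      using that \<open>y < z\<close> by (intro G) auto
    note sw = binomial_expansion_swap(2)[OF abs_summ[OF y0 \<open>y < z\<close>] G' pos(3) w0 s(1,2) wy]
    \<comment> \<open>The prefactor is moved to the left so that both sequences are coefficients of
      the same function G (w (1 - s)^\<nu>).\<close>
    have "(\<lambda>k. exp (- (t * \<eta> powr \<delta>)) * q k x) =
        (\<lambda>k. (-1) ^ k * (\<Sum>m. c m * w ^ m * (\<nu> * real m gchoose k)))"
    proof (rule power_series_coeffs_unique)
      fix s' assume s': "0 \<le> s'" "s' < s"
      then show "(\<lambda>k. (-1) ^ k * (\<Sum>m. c m * w ^ m * (\<nu> * real m gchoose k)) * s' ^ k)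
          sums G (w * (1 - s') powr \<nu>)"
        by (intro sw) auto
      have "\<eta> + (x * (1 - s')) powr \<nu> = \<eta> * (1 + w * (1 - s') powr \<nu>)"
        using x s' s pos powr_mult[of x "1 - s'" \<nu>] by (simp add: w_def field_simps)
      then have "(\<eta> + (x * (1 - s')) powr \<nu>) powr \<delta> = \<eta> powr \<delta> * (1 + w * (1 - s') powr \<nu>) powr \<delta>"
        using pos w0 by (simp add: powr_mult)
      then have "exp (- t * (\<eta> + (x * (1 - s')) powr \<nu>) powr \<delta>) = G (w * (1 - s') powr \<nu>)"
        by (simp add: G_def mult_ac)
      with sums_mult[OF gen[of x s'], of "exp (- (t * \<eta> powr \<delta>))"] x s' s
      have "(\<lambda>k. exp (- (t * \<eta> powr \<delta>)) * (q k x * s' ^ k)) sums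
          (exp (- (t * \<eta> powr \<delta>)) * (exp (t * \<eta> powr \<delta>) * G (w * (1 - s') powr \<nu>)))"
        by simp
      moreover have "exp (- (t * \<eta> powr \<delta>)) * (exp (t * \<eta> powr \<delta>) * a) = a" for a
        by (simp flip: mult.assoc exp_add)
      ultimately show "(\<lambda>k. exp (- (t * \<eta> powr \<delta>)) * q k x * s' ^ k) sums G (w * (1 - s') powr \<nu>)"
        by (simp only: mult.assoc)
    qed (use s in auto)
    then have "exp (- (t * \<eta> powr \<delta>)) * q k x = (-1) ^ k * (\<Sum>m. c m * w ^ m * (\<nu> * real m gchoose k))"
      by (rule fun_cong)
    then have "q k x = exp (t * \<eta> powr \<delta>) * ((-1) ^ k * (\<Sum>m. c m * w ^ m * (\<nu> * real m gchoose k)))"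
      by (simp add: exp_minus field_simps)
    moreover have "c m * w ^ m * (\<nu> * real m gchoose k)
        = c m * z ^ m * (\<nu> * real m gchoose k) * ((x / rate) powr \<nu>) ^ m" for m
    proof -
      have "w = z * (x / rate) powr \<nu>" using x by (simp add: w_def z_def powr_divide)
      then show ?thesis by (simp add: power_mult_distrib)
    qed
    ultimately show ?thesis by (simp only:)
  qed
  \<comment> \<open>The Abel variable \<rho> = (x / rate)^\<nu> increases strictly to 1 as x
    increases to the rate.\<close>
  have lim: "filterlim (\<lambda>x. (x / rate) powr \<nu>) (at_left 1) (at_left rate)"
    unfolding filterlim_at
  proof (intro conjI)
    have ev: "eventually (\<lambda>x. x \<in> {0<..<rate}) (at_left rate)"
      using \<open>rate > 0\<close> by (intro eventually_at_left_real)
    then show "eventually (\<lambda>x. (x / rate) powr \<nu> \<in> {..<1} \<and> (x / rate) powr \<nu> \<noteq> 1) (at_left rate)"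
    proof eventually_elim
      case (elim x)
      then have "(x / rate) powr \<nu> < 1 powr \<nu>"
        using pos by (intro powr_less_mono2) auto
      then show ?case by simp
    qed
    have "((\<lambda>x. (x / rate) powr \<nu>) \<longlongrightarrow> (rate / rate) powr \<nu>) (at_left rate)"
      using \<open>rate > 0\<close> by (intro tendsto_intros) auto
    then show "((\<lambda>x. (x / rate) powr \<nu>) \<longlongrightarrow> 1) (at_left rate)" using \<open>rate > 0\<close> by simp
  qed
  have "((\<lambda>x. exp (t * \<eta> powr \<delta>) * ((-1) ^ k *
      (\<Sum>m. c m * z ^ m * (\<nu> * real m gchoose k) * ((x / rate) powr \<nu>) ^ m))) \<longlongrightarrow>
      exp (t * \<eta> powr \<delta>) * ((-1) ^ k * (\<Sum>m. c m * z ^ m * (\<nu> * real m gchoose k)))) (at_left rate)"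
    by (intro tendsto_mult_left filterlim_compose[OF Abel_limit lim]) (use summ in \<open>simp add: z_def\<close>)
  moreover have "eventually (\<lambda>x. x \<in> {0<..<rate}) (at_left rate)"
    using \<open>rate > 0\<close> by (intro eventually_at_left_real)
  then have "eventually (\<lambda>x. exp (t * \<eta> powr \<delta>) * ((-1) ^ k *
      (\<Sum>m. c m * z ^ m * (\<nu> * real m gchoose k) * ((x / rate) powr \<nu>) ^ m)) = q k x) (at_left rate)"
    by eventually_elim (simp add: eq)
  ultimately have "(q k \<longlongrightarrow> exp (t * \<eta> powr \<delta>) * ((-1) ^ k * (\<Sum>m. c m * z ^ m * (\<nu> * real m gchoose k))))
      (at_left rate)"
    by (simp add: tendsto_cong)
  from tendsto_unique[OF _ cont this] show ?thesis by (simp add: z_def)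
qed

end

subsection \<open>Processes at independent random times\<close>

text \<open>The right end of the j-th cell of mesh 1 / (m + 1); the \<open>+ 1\<close> puts it
  strictly to the right of every point of the half-open cell.\<close>

definition grid_time :: "nat \<Rightarrow> nat \<Rightarrow> real" where
  "grid_time m j = (real j + 1) / real (Suc m)"

definition grid_index :: "nat \<Rightarrow> real \<Rightarrow> nat" where
  "grid_index m u = nat \<lfloor>real (Suc m) * u\<rfloor>"

lemma grid_time_at_right:
  assumes "u \<ge> 0"
  shows "filterlim (\<lambda>m. grid_time m (grid_index m u)) (at_right u) sequentially"
  unfolding filterlim_at
proof (intro conjI always_eventually allI)
  have bounds: "u < grid_time m (grid_index m u)" "grid_time m (grid_index m u) \<le> u + 1 / real (Suc m)" for m
  proof -
    have "real (grid_index m u) = of_int \<lfloor>real (Suc m) * u\<rfloor>"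
      using assms by (simp add: grid_index_def)
    then have "real (Suc m) * u < real (grid_index m u) + 1" "real (grid_index m u) + 1 \<le> real (Suc m) * u + 1"
      by linarith+
    then have "(real (Suc m) * u) / real (Suc m) < grid_time m (grid_index m u)"
      "grid_time m (grid_index m u) \<le> (real (Suc m) * u + 1) / real (Suc m)"
      unfolding grid_time_def by (intro divide_strict_right_mono divide_right_mono; simp)+
    then show "u < grid_time m (grid_index m u)" "grid_time m (grid_index m u) \<le> u + 1 / real (Suc m)"
      by (simp_all add: add_divide_distrib del: of_nat_Suc)
  qed
  show "grid_time m (grid_index m u) \<in> {u<..}" "grid_time m (grid_index m u) \<noteq> u" for m
    using bounds(1)[of m] by auto
  have "(\<lambda>m. u + 1 / real (Suc m)) \<longlonglongrightarrow> u + 0"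
    by (intro tendsto_intros LIMSEQ_Suc lim_1_over_n)
  then have upper: "(\<lambda>m. u + 1 / real (Suc m)) \<longlonglongrightarrow> u" by (simp only: add_0_right)
  show "(\<lambda>m. grid_time m (grid_index m u)) \<longlonglongrightarrow> u"
  proof (rule tendsto_sandwich[OF _ _ tendsto_const upper])
    show "eventually (\<lambda>m. u \<le> grid_time m (grid_index m u)) sequentially"
      by (rule always_eventually) (blast intro: less_imp_le bounds(1))
    show "eventually (\<lambda>m. grid_time m (grid_index m u) \<le> u + 1 / real (Suc m)) sequentially"
      by (rule always_eventually) (blast intro: bounds(2))
  qed
qed

text \<open>Bridges independence of the sigma-algebras generated by whole processes to independence
  of two random variables measurable with respect to them.\<close>

lemma (in prob_space) indep_var_of_indep_set:
  assumes ind: "indep_set (sigma_sets (space M) A) (sigma_sets (space M) B)"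
    and X: "\<And>S. S \<in> sets N \<Longrightarrow> X -` S \<inter> space M \<in> sigma_sets (space M) A" "X \<in> space M \<rightarrow> space N"
    and Y: "\<And>S. S \<in> sets L \<Longrightarrow> Y -` S \<inter> space M \<in> sigma_sets (space M) B" "Y \<in> space M \<rightarrow> space L"
  shows "indep_var N X L Y"
  unfolding indep_var_eq
proof (intro conjI)
  show "random_variable N X" "random_variable L Y"
    using X Y indep_setD_ev1[OF ind] indep_setD_ev2[OF ind] by (auto intro!: measurableI)
  have "sigma_sets (space M) {X -` S \<inter> space M |S. S \<in> sets N} \<subseteq> sigma_sets (space M) A"
    by (intro sigma_sets_mono) (use X in auto)
  moreover have "sigma_sets (space M) {Y -` S \<inter> space M |S. S \<in> sets L} \<subseteq> sigma_sets (space M) B"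
    by (intro sigma_sets_mono) (use Y in auto)
  ultimately show "indep_set (sigma_sets (space M) {X -` S \<inter> space M |S. S \<in> sets N})
      (sigma_sets (space M) {Y -` S \<inter> space M |S. S \<in> sets L})"
    using ind unfolding indep_sets2_eq by blast
qed

text \<open>
  The time is approximated by grid times from the right, so that no joint measurability of
  \<open>(s, \<omega>) \<mapsto> Z s \<omega>\<close> is needed.
\<close>

lemma (in prob_space) expectation_random_time:
  fixes Z :: "real \<Rightarrow> 'a \<Rightarrow> real" and T :: "'a \<Rightarrow> real" and \<psi> :: "real \<Rightarrow> real"
  assumes ind: "\<And>s. s \<ge> 0 \<Longrightarrow> indep_var borel (Z s) borel T"
    and T: "\<And>\<omega>. \<omega> \<in> space M \<Longrightarrow> T \<omega> \<ge> 0"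
    and Z_nonneg: "\<And>s \<omega>. s \<ge> 0 \<Longrightarrow> \<omega> \<in> space M \<Longrightarrow> 0 \<le> Z s \<omega>"
    and Z_le: "\<And>s \<omega>. s \<ge> 0 \<Longrightarrow> \<omega> \<in> space M \<Longrightarrow> Z s \<omega> \<le> B"
    and Z_rc: "\<And>s \<omega>. s \<ge> 0 \<Longrightarrow> \<omega> \<in> space M \<Longrightarrow> continuous (at_right s) (\<lambda>s. Z s \<omega>)"
    and \<psi>: "\<And>s. s \<ge> 0 \<Longrightarrow> expectation (Z s) = \<psi> s"
    and \<psi>_cont: "\<And>s. s \<ge> 0 \<Longrightarrow> continuous (at_right s) \<psi>"
  shows "(\<lambda>\<omega>. Z (T \<omega>) \<omega>) \<in> borel_measurable M \<and>
    expectation (\<lambda>\<omega>. Z (T \<omega>) \<omega>) = expectation (\<lambda>\<omega>. \<psi> (T \<omega>))"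
proof -
  have Z_bounds: "0 \<le> Z s \<omega> \<and> Z s \<omega> \<le> B" if "s \<ge> 0" "\<omega> \<in> space M" for s \<omega>
    using Z_nonneg[OF that] Z_le[OF that] by simp
  have [measurable]: "T \<in> borel_measurable M"
    using ind[of 0] by (simp add: indep_var_eq)
  have Z_meas: "Z s \<in> borel_measurable M" if "s \<ge> 0" for s
    using ind[OF that] by (simp add: indep_var_eq)
  have grid0: "grid_time m j \<ge> 0" for m j by (simp add: grid_time_def)
  note [measurable] = Z_meas[OF grid0]
  define J where "J = (\<lambda>m \<omega>. grid_index m (T \<omega>))"
  have J_meas [measurable]: "J m \<in> measurable M (count_space UNIV)" for m
    unfolding J_def grid_index_def by measurable
  define ZJ where "ZJ = (\<lambda>m \<omega>. Z (grid_time m (J m \<omega>)) \<omega>)"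
  define \<psi>J where "\<psi>J = (\<lambda>m \<omega>. \<psi> (grid_time m (J m \<omega>)))"
  have ZJ_meas [measurable]: "ZJ m \<in> borel_measurable M" for m
    unfolding ZJ_def by (rule measurable_compose_countable[OF _ J_meas]) measurable
  have \<psi>J_meas [measurable]: "\<psi>J m \<in> borel_measurable M" for m
    unfolding \<psi>J_def by (rule measurable_compose_countable[OF _ J_meas]) measurable
  have int_Z: "integrable M (Z s)" if "s \<ge> 0" for s
    using Z_bounds[OF that] Z_meas[OF that] by (intro integrable_const_bound[of _ B]) auto
  have B: "B \<ge> 0" using Z_bounds[of 0] not_empty by fastforce
  have \<psi>_bounds: "0 \<le> \<psi> s \<and> \<psi> s \<le> B" if "s \<ge> 0" for s
  proof -
    have "expectation (Z s) \<ge> 0" using Z_bounds[OF that] by (intro Bochner_Integration.integral_nonneg_AE) auto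
    moreover have "expectation (Z s) \<le> B"
      using Z_bounds[OF that] int_Z[OF that] by (intro integral_le_const) auto
    ultimately show ?thesis by (simp add: \<psi> that)
  qed
  have eq: "expectation (ZJ m) = expectation (\<psi>J m)" for m
  proof -
    \<comment> \<open>On the event \<open>J m = j\<close> the approximating time is a constant. The
      indicator of this event is a function \<open>h\<close> of \<open>T\<close>, hence independent
      of \<open>Z\<close> at that constant time, and the expectation factorizes.\<close>
    have part: "(\<integral>\<^sup>+\<omega>. ennreal (Z (grid_time m j) \<omega>) * indicator {\<omega>. J m \<omega> = j} \<omega> \<partial>M)
        = (\<integral>\<^sup>+\<omega>. ennreal (\<psi> (grid_time m j)) * indicator {\<omega>. J m \<omega> = j} \<omega> \<partial>M)" for j
    proof -
      define h where "h = (\<lambda>u. indicator {u. grid_index m u = j} u :: real)"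
      have [measurable]: "h \<in> borel_measurable borel"
        unfolding h_def grid_index_def by measurable
      let ?Z = "Z (grid_time m j)"
      have int_h: "integrable M (\<lambda>\<omega>. h (T \<omega>))"
      proof (rule integrable_const_bound[of _ 1])
        show "AE \<omega> in M. norm (h (T \<omega>)) \<le> 1" by (auto simp: h_def indicator_def)
      qed measurable
      have "indep_var borel ((\<lambda>z. z) \<circ> ?Z) borel (h \<circ> T)"
        by (rule indep_var_compose[OF ind[OF grid0]]) auto
      then have iv: "indep_var borel ?Z borel (\<lambda>\<omega>. h (T \<omega>))" by (simp add: comp_def)
      have h_eq: "indicator {\<omega>. J m \<omega> = j} \<omega> = ennreal (h (T \<omega>))" for \<omega>
        by (auto simp: h_def J_def indicator_def)
      have h0: "h u \<ge> 0" for u by (simp add: h_def)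
      have "(\<integral>\<^sup>+\<omega>. ennreal (?Z \<omega>) * indicator {\<omega>. J m \<omega> = j} \<omega> \<partial>M) = (\<integral>\<^sup>+\<omega>. ennreal (?Z \<omega> * h (T \<omega>)) \<partial>M)"
        using Z_bounds[OF grid0] h0 by (intro nn_integral_cong) (simp add: h_eq ennreal_mult)
      also have "\<dots> = ennreal (expectation (\<lambda>\<omega>. ?Z \<omega> * h (T \<omega>)))"
        using Z_bounds[OF grid0] h0 indep_var_integrable[OF iv int_Z[OF grid0] int_h]
        by (intro nn_integral_eq_integral) auto
      also have "expectation (\<lambda>\<omega>. ?Z \<omega> * h (T \<omega>)) = \<psi> (grid_time m j) * expectation (\<lambda>\<omega>. h (T \<omega>))"
        using indep_var_lebesgue_integral[OF iv int_Z[OF grid0] int_h] by (simp add: \<psi> grid0)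
      also have "\<dots> = expectation (\<lambda>\<omega>. \<psi> (grid_time m j) * h (T \<omega>))" by simp
      also have "ennreal \<dots> = (\<integral>\<^sup>+\<omega>. ennreal (\<psi> (grid_time m j) * h (T \<omega>)) \<partial>M)"
        using \<psi>_bounds[OF grid0] h0 int_h by (intro nn_integral_eq_integral[symmetric]) auto
      also have "\<dots> = (\<integral>\<^sup>+\<omega>. ennreal (\<psi> (grid_time m j)) * indicator {\<omega>. J m \<omega> = j} \<omega> \<partial>M)"
        using \<psi>_bounds[OF grid0] h0 by (intro nn_integral_cong) (simp add: h_eq ennreal_mult)
      finally show ?thesis .
    qed
    \<comment> \<open>The cells partition the space; nonnegative integrals let the countable sum be
      interchanged freely.\<close>
    have split: "(\<Sum>j. g j * indicator {\<omega>. J m \<omega> = j} \<omega>) = (g (J m \<omega>) :: ennreal)" for g \<omega>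
      by (subst suminf_finite[of "{J m \<omega>}"]) (auto simp: indicator_def)
    have meas_J: "{\<omega>. J m \<omega> = j} \<inter> space M \<in> sets M" for j
    proof -
      have "{\<omega>. J m \<omega> = j} \<inter> space M = J m -` {j} \<inter> space M" by auto
      then show ?thesis using measurable_sets[OF J_meas, of "{j}"] by simp
    qed
    have [measurable]: "(\<lambda>\<omega>. indicator {\<omega>. J m \<omega> = j} \<omega> :: ennreal) \<in> borel_measurable M" for j
      using meas_J by (simp add: borel_measurable_indicator_iff)
    have "(\<integral>\<^sup>+\<omega>. ennreal (ZJ m \<omega>) \<partial>M)
        = (\<integral>\<^sup>+\<omega>. (\<Sum>j. ennreal (Z (grid_time m j) \<omega>) * indicator {\<omega>. J m \<omega> = j} \<omega>) \<partial>M)"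
      by (simp add: ZJ_def split)
    also have "\<dots> = (\<Sum>j. \<integral>\<^sup>+\<omega>. ennreal (Z (grid_time m j) \<omega>) * indicator {\<omega>. J m \<omega> = j} \<omega> \<partial>M)"
      by (rule nn_integral_suminf) measurable
    also have "\<dots> = (\<Sum>j. \<integral>\<^sup>+\<omega>. ennreal (\<psi> (grid_time m j)) * indicator {\<omega>. J m \<omega> = j} \<omega> \<partial>M)"
      by (simp only: part)
    also have "\<dots> = (\<integral>\<^sup>+\<omega>. (\<Sum>j. ennreal (\<psi> (grid_time m j)) * indicator {\<omega>. J m \<omega> = j} \<omega>) \<partial>M)"
      by (rule nn_integral_suminf[symmetric]) measurable
    also have "\<dots> = (\<integral>\<^sup>+\<omega>. ennreal (\<psi>J m \<omega>) \<partial>M)"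
      by (simp add: \<psi>J_def split)
    finally show ?thesis
      using Z_bounds[OF grid0] \<psi>_bounds[OF grid0]
      by (subst (1 2) integral_eq_nn_integral) (auto simp: ZJ_def[symmetric] \<psi>J_def[symmetric] intro!: AE_I2, auto simp: ZJ_def \<psi>J_def)
  qed
  have lim_Z: "(\<lambda>m. ZJ m \<omega>) \<longlonglongrightarrow> Z (T \<omega>) \<omega>" if "\<omega> \<in> space M" for \<omega>
    using Z_rc[OF T[OF that] that] filterlim_compose[OF _ grid_time_at_right[OF T[OF that]]]
    unfolding continuous_within ZJ_def J_def by blast
  have lim_\<psi>: "(\<lambda>m. \<psi>J m \<omega>) \<longlonglongrightarrow> \<psi> (T \<omega>)" if "\<omega> \<in> space M" for \<omega>
    using \<psi>_cont[OF T[OF that]] filterlim_compose[OF _ grid_time_at_right[OF T[OF that]]]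
    unfolding continuous_within \<psi>J_def J_def by blast
  have meas: "(\<lambda>\<omega>. Z (T \<omega>) \<omega>) \<in> borel_measurable M"
    by (rule borel_measurable_LIMSEQ_real[OF lim_Z ZJ_meas])
  have meas': "(\<lambda>\<omega>. \<psi> (T \<omega>)) \<in> borel_measurable M"
    by (rule borel_measurable_LIMSEQ_real[OF lim_\<psi> \<psi>J_meas])
  \<comment> \<open>Refining the grid, both sides converge by right continuity with the common
    dominating constant \<open>B\<close>.\<close>
  have "(\<lambda>m. expectation (ZJ m)) \<longlonglongrightarrow> expectation (\<lambda>\<omega>. Z (T \<omega>) \<omega>)"
    by (rule integral_dominated_convergence[where w = "\<lambda>_. B"])
       (use meas lim_Z Z_bounds[OF grid0] in \<open>auto simp: ZJ_def\<close>)
  moreover have "(\<lambda>m. expectation (\<psi>J m)) \<longlonglongrightarrow> expectation (\<lambda>\<omega>. \<psi> (T \<omega>))"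
    by (rule integral_dominated_convergence[where w = "\<lambda>_. B"])
       (use meas' lim_\<psi> \<psi>_bounds[OF grid0] in \<open>auto simp: \<psi>J_def\<close>)
  ultimately have "expectation (\<lambda>\<omega>. Z (T \<omega>) \<omega>) = expectation (\<lambda>\<omega>. \<psi> (T \<omega>))"
    using LIMSEQ_unique by (simp add: eq)
  with meas show ?thesis by simp
qed

text \<open>A single term of the exponential series is at most the whole sum. The bound 1 serves as
  dominating constant for Poisson weights.\<close>

lemma exp_minus_power_le_1:
  assumes "(y::real) \<ge> 0"
  shows "exp (- y) * (y ^ k / fact k) \<le> 1"
proof -
  have "y ^ k / fact k \<le> exp y"
    using sum_le_suminf[of "\<lambda>k. y ^ k / fact k" "{k}"] exp_series_sums[of y] assms
    by (simp add: sums_iff)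
  then have "exp (- y) * (y ^ k / fact k) \<le> exp (- y) * exp y" by (intro mult_left_mono) auto
  then show ?thesis by (simp flip: exp_add)
qed

section \<open>Mixed Poisson probabilities as functions of the rate\<close>

context prob_space
begin

text \<open>The probability of k for a Poisson variable with random mean x Y. The rate is the last
  argument so that it can vary while \<open>Y\<close> stays fixed.\<close>

definition mixed_poisson :: "('a \<Rightarrow> real) \<Rightarrow> nat \<Rightarrow> real \<Rightarrow> real" where
  "mixed_poisson Y k x = expectation (\<lambda>\<omega>. exp (- (x * Y \<omega>)) * ((x * Y \<omega>) ^ k / fact k))"

text \<open>For fixed Y this is the Poisson generating function exp (- x (1 - s) Y). The partial
  sums are nonnegative and at most 1, so dominated convergence moves the expectation inside.\<close>

lemma mixed_poisson_generating_function:
  assumes [measurable]: "Y \<in> borel_measurable M" and Y: "\<And>\<omega>. \<omega> \<in> space M \<Longrightarrow> Y \<omega> \<ge> 0"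
    and "x > 0" "0 \<le> s" "s < 1"
  shows "(\<lambda>k. mixed_poisson Y k x * s ^ k) sums expectation (\<lambda>\<omega>. exp (- (x * (1 - s)) * Y \<omega>))"
proof -
  define f where "f = (\<lambda>k \<omega>. exp (- (x * Y \<omega>)) * ((x * Y \<omega>) ^ k / fact k) * s ^ k)"
  have [measurable]: "f k \<in> borel_measurable M" for k unfolding f_def by measurable
  have f0: "f k \<omega> \<ge> 0" if "\<omega> \<in> space M" for k \<omega>
    using Y[OF that] assms by (simp add: f_def)
  have f_sums: "(\<lambda>k. f k \<omega>) sums exp (- (x * (1 - s)) * Y \<omega>)" for \<omega>
  proof -
    have "f k \<omega> = exp (- (x * Y \<omega>)) * ((x * Y \<omega> * s) ^ k / fact k)" for k
      by (simp add: f_def power_mult_distrib)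
    moreover have "exp (- (x * (1 - s)) * Y \<omega>) = exp (- (x * Y \<omega>)) * exp (x * Y \<omega> * s)"
      unfolding exp_add[symmetric] by (simp add: algebra_simps)
    ultimately show ?thesis
      using sums_mult[OF exp_series_sums[of "x * Y \<omega> * s"], of "exp (- (x * Y \<omega>))"] by simp
  qed
  have int_f: "integrable M (f k)" for k
  proof (rule integrable_const_bound[of _ 1])
    show "AE \<omega> in M. norm (f k \<omega>) \<le> 1"
    proof (rule AE_I2)
      fix \<omega> assume \<omega>: "\<omega> \<in> space M"
      have "f k \<omega> \<le> 1 * 1" unfolding f_def
        by (intro mult_mono exp_minus_power_le_1 power_le_one) (use assms Y[OF \<omega>] in auto)
      then show "norm (f k \<omega>) \<le> 1" using f0[OF \<omega>] by simp
    qed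
  qed measurable
  have "(\<lambda>K. expectation (\<lambda>\<omega>. \<Sum>k<K. f k \<omega>)) \<longlonglongrightarrow> expectation (\<lambda>\<omega>. exp (- (x * (1 - s)) * Y \<omega>))"
  proof (rule integral_dominated_convergence[where w = "\<lambda>_. 1"])
    show "AE \<omega> in M. (\<lambda>K. \<Sum>k<K. f k \<omega>) \<longlonglongrightarrow> exp (- (x * (1 - s)) * Y \<omega>)"
      using f_sums by (simp add: sums_def)
    show "AE \<omega> in M. norm (\<Sum>k<K. f k \<omega>) \<le> 1" for K
    proof (rule AE_I2)
      fix \<omega> assume \<omega>: "\<omega> \<in> space M"
      have "(\<Sum>k<K. f k \<omega>) \<le> exp (- (x * (1 - s)) * Y \<omega>)"
        using f_sums[of \<omega>] f0[OF \<omega>] sum_le_suminf[of "\<lambda>k. f k \<omega>" "{..<K}"] by (simp add: sums_iff)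
      also have "\<dots> \<le> 1" using Y[OF \<omega>] assms by simp
      finally show "norm (\<Sum>k<K. f k \<omega>) \<le> 1" using f0[OF \<omega>] by (simp add: sum_nonneg)
    qed
  qed auto
  moreover have "expectation (\<lambda>\<omega>. \<Sum>k<K. f k \<omega>) = (\<Sum>k<K. mixed_poisson Y k x * s ^ k)" for K
    using int_f by (simp add: Bochner_Integration.integral_sum) (simp add: f_def mixed_poisson_def)
  ultimately show ?thesis by (simp add: sums_def)
qed

lemma mixed_poisson_at_left:
  assumes [measurable]: "Y \<in> borel_measurable M" and Y: "\<And>\<omega>. \<omega> \<in> space M \<Longrightarrow> Y \<omega> \<ge> 0"
    and "x > 0"
  shows "(mixed_poisson Y k \<longlongrightarrow> mixed_poisson Y k x) (at_left x)"
proof (rule tendsto_at_left_sequentially[of 0])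
  fix X assume X: "\<And>n. X n < x" "\<And>n. 0 < X n" "X \<longlonglongrightarrow> x"
  show "(\<lambda>n. mixed_poisson Y k (X n)) \<longlonglongrightarrow> mixed_poisson Y k x"
    unfolding mixed_poisson_def
  proof (rule integral_dominated_convergence[where w = "\<lambda>_. 1"])
    show "AE \<omega> in M. (\<lambda>n. exp (- (X n * Y \<omega>)) * ((X n * Y \<omega>) ^ k / fact k))
        \<longlonglongrightarrow> exp (- (x * Y \<omega>)) * ((x * Y \<omega>) ^ k / fact k)"
      by (intro AE_I2 tendsto_intros X) auto
    show "AE \<omega> in M. norm (exp (- (X n * Y \<omega>)) * ((X n * Y \<omega>) ^ k / fact k)) \<le> 1" for n
    proof (rule AE_I2)
      fix \<omega> assume "\<omega> \<in> space M"
      then have "X n * Y \<omega> \<ge> 0" using X(2)[of n] Y by simp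
      then show "norm (exp (- (X n * Y \<omega>)) * ((X n * Y \<omega>) ^ k / fact k)) \<le> 1"
        using exp_minus_power_le_1[of "X n * Y \<omega>" k] by simp
    qed
  qed auto
qed (use \<open>x > 0\<close> in auto)

end

subsection \<open>The subordinated Poisson process\<close>

lemma vimage_in_process_events:
  assumes "t \<ge> 0" "S \<in> sets borel"
  shows "X t -` S \<inter> space M \<in> process_events M X"
  using assms unfolding process_events_def by (intro sigma_sets.Basic) auto

lemma process_events_subset_Pow: "process_events M X \<subseteq> Pow (space M)"
proof
  fix E assume "E \<in> process_events M X"
  then have "E \<subseteq> space M" unfolding process_events_def by (rule sigma_sets_into_sp[rotated]) auto
  then show "E \<in> Pow (space M)" by simp
qed

lemma (in prob_space) indep_set_commute:
  assumes "indep_set A B"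
  shows "indep_set B A"
proof (rule indep_setI)
  fix b a assume "b \<in> B" "a \<in> A"
  then show "prob (b \<inter> a) = prob b * prob a"
    using indep_setD[OF assms, of a b] by (simp add: Int_commute mult.commute)
qed (use indep_setD_ev1[OF assms] indep_setD_ev2[OF assms] in auto)

section \<open>Laplace transforms of the mixture and of the random time\<close>

text \<open>By independence the transforms multiply. The weights are such that their (\<nu> r)-th
  powers are the binomial coefficients times powers of \<eta>, so the exponents add up to a binomial
  expansion whose term r = 0, namely \<eta>^n, is missing.\<close>

lemma stable_mixture_laplace:
  assumes "prob_space M" and "\<eta> > 0" "\<nu> > 0"
    and V: "\<And>r. r \<in> {1..n} \<Longrightarrow> stable_subordinator M (\<nu> * real r) (V r)"
    and ind: "prob_space.indep_sets M (\<lambda>r. process_events M (V r)) {1..n}"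
    and "s \<ge> 0" "x \<ge> 0"
  shows "prob_space.expectation M (\<lambda>\<omega>. exp (- (x * stable_mixture \<eta> \<nu> n V s \<omega>)))
    = exp (- s * ((\<eta> + x powr \<nu>) ^ n - \<eta> ^ n))"
proof -
  interpret prob_space M by fact
  define a where "a = (\<lambda>r. real (n choose r) powr (1 / (\<nu> * real r)) * \<eta> powr (real (n - r) / (\<nu> * real r)))"
  have meas: "V r s \<in> borel_measurable M" if "r \<in> {1..n}" for r
    using V[OF that] \<open>s \<ge> 0\<close> by (simp add: stable_subordinator_def subordinator_def)
  have V0: "V r s \<omega> \<ge> 0" if "r \<in> {1..n}" "\<omega> \<in> space M" for r \<omega>
  proof -
    have "mono_on {0..} (\<lambda>t. V r t \<omega>)" "V r 0 \<omega> = 0"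
      using V[OF that(1)] that(2)
      by (auto simp: stable_subordinator_def subordinator_def increasing_rc_paths_def)
    then show ?thesis using \<open>s \<ge> 0\<close> mono_onD[of "{0..}" "\<lambda>t. V r t \<omega>" 0 s] by simp
  qed
  have a0: "a r \<ge> 0" for r by (simp add: a_def)
  have indV: "indep_vars (\<lambda>_. borel) (\<lambda>r. V r s) {1..n}"
    unfolding indep_vars_def2
  proof (intro conjI ballI)
    show "indep_sets (\<lambda>r. {V r s -` A \<inter> space M |A. A \<in> sets borel}) {1..n}"
      by (rule indep_sets_mono_sets[OF ind]) (use \<open>s \<ge> 0\<close> in \<open>auto intro: vimage_in_process_events\<close>)
  qed (rule meas)
  have indE: "indep_vars (\<lambda>_. borel) (\<lambda>r \<omega>. exp (- (x * a r) * V r s \<omega>)) {1..n}"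
    by (rule indep_vars_compose2[OF indV, of "\<lambda>r v. exp (- (x * a r) * v)"]) auto
  have intE: "integrable M (\<lambda>\<omega>. exp (- (x * a r) * V r s \<omega>))" if "r \<in> {1..n}" for r
    using meas[OF that] V0[OF that] a0[of r] \<open>x \<ge> 0\<close>
    by (intro integrable_const_bound[of _ 1]) auto
  have "(\<lambda>\<omega>. exp (- (x * stable_mixture \<eta> \<nu> n V s \<omega>))) = (\<lambda>\<omega>. \<Prod>r\<in>{1..n}. exp (- (x * a r) * V r s \<omega>))"
    by (simp add: exp_sum[symmetric] stable_mixture_def a_def sum_distrib_left sum_negf mult_ac)
  then have "expectation (\<lambda>\<omega>. exp (- (x * stable_mixture \<eta> \<nu> n V s \<omega>)))
      = (\<Prod>r\<in>{1..n}. expectation (\<lambda>\<omega>. exp (- (x * a r) * V r s \<omega>)))"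
    by (simp only: indep_vars_lebesgue_integral[OF finite_atLeastAtMost indE intE])
  also have "\<dots> = (\<Prod>r\<in>{1..n}. exp (- s * (real (n choose r) * (x powr \<nu>) ^ r * \<eta> ^ (n - r))))"
  proof (rule prod.cong[OF refl])
    fix r assume r: "r \<in> {1..n}"
    have "a r powr (\<nu> * real r) = real (n choose r) * \<eta> ^ (n - r)"
      using r \<open>\<nu> > 0\<close> \<open>\<eta> > 0\<close> by (simp add: a_def powr_mult powr_powr powr_realpow del: of_nat_diff)
    \<comment> \<open>At \<open>x = 0\<close> both sides are 0 because r \<ge> 1.\<close>
    moreover have "x powr (\<nu> * real r) = (x powr \<nu>) ^ r"
      using r \<open>x \<ge> 0\<close> powr_powr[of x \<nu> "real r"] powr_realpow[of "x powr \<nu>" r]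
      by (cases "x = 0") auto
    ultimately have "(x * a r) powr (\<nu> * real r) = real (n choose r) * (x powr \<nu>) ^ r * \<eta> ^ (n - r)"
      using a0[of r] \<open>x \<ge> 0\<close> by (simp add: powr_mult)
    moreover have "expectation (\<lambda>\<omega>. exp (- (x * a r) * V r s \<omega>)) = exp (- s * (x * a r) powr (\<nu> * real r))"
      using V[OF r] a0[of r] \<open>x \<ge> 0\<close> \<open>s \<ge> 0\<close>
      unfolding stable_subordinator_def has_laplace_exponent_def by simp
    ultimately show "expectation (\<lambda>\<omega>. exp (- (x * a r) * V r s \<omega>))
        = exp (- s * (real (n choose r) * (x powr \<nu>) ^ r * \<eta> ^ (n - r)))"
      by simp
  qed
  also have "\<dots> = exp (- s * (\<Sum>r=1..n. real (n choose r) * (x powr \<nu>) ^ r * \<eta> ^ (n - r)))"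
    by (simp add: exp_sum[symmetric] sum_distrib_left)
  also have "(\<Sum>r=1..n. real (n choose r) * (x powr \<nu>) ^ r * \<eta> ^ (n - r)) = (\<eta> + x powr \<nu>) ^ n - \<eta> ^ n"
  proof -
    have "(\<eta> + x powr \<nu>) ^ n = (\<Sum>r=0..n. real (n choose r) * (x powr \<nu>) ^ r * \<eta> ^ (n - r))"
      using binomial_ring[of "x powr \<nu>" \<eta> n] by (simp add: add.commute atMost_atLeast0)
    also have "\<dots> = \<eta> ^ n + (\<Sum>r=1..n. real (n choose r) * (x powr \<nu>) ^ r * \<eta> ^ (n - r))"
      by (subst sum.atLeast_Suc_atMost) auto
    finally show ?thesis by simp
  qed
  finally show ?thesis .
qed

text \<open>Given \<open>W t\<close>, the transform of the mixture is exp (- \<mu> W t) with \<mu> =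
  (\<eta> + x^\<nu>)^n - \<eta>^n. Inside the Laplace exponent of \<open>W\<close> the terms
  \<eta>^n cancel, and the n-th root combines with the n-th power to give the exponent
  \<delta>.\<close>

lemma subordinated_mixture:
  assumes "prob_space M" and "\<delta> > 0" "\<eta> > 0" "\<nu> > 0" "n > 0"
    and V: "\<And>r. r \<in> {1..n} \<Longrightarrow> stable_subordinator M (\<nu> * real r) (V r)"
    and indV: "prob_space.indep_sets M (\<lambda>r. process_events M (V r)) {1..n}"
    and W: "subordinator M W"
      "has_laplace_exponent M W (\<lambda>\<mu>. (\<eta> ^ n + \<mu>) powr (\<delta> / real n) - \<eta> powr \<delta>)"
    and indW: "prob_space.indep_set M (process_events M W) (family_events M {1..n} V)"
    and "t \<ge> 0"
  defines "Y \<equiv> time_change (stable_mixture \<eta> \<nu> n V) W t"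
  shows "Y \<in> borel_measurable M"
    and "\<And>\<omega>. \<omega> \<in> space M \<Longrightarrow> Y \<omega> \<ge> 0"
    and "\<And>x. x \<ge> 0 \<Longrightarrow> prob_space.expectation M (\<lambda>\<omega>. exp (- x * Y \<omega>))
      = exp (t * \<eta> powr \<delta>) * exp (- t * (\<eta> + x powr \<nu>) powr \<delta>)"
proof -
  interpret prob_space M by fact
  define X where "X = stable_mixture \<eta> \<nu> n V"
  define A where "A = (\<Union>r\<in>{1..n}. process_events M (V r))"
  have fam: "family_events M {1..n} V = sigma_sets (space M) A"
    by (simp add: family_events_def A_def)
  have "A \<subseteq> Pow (space M)" using process_events_subset_Pow by (fastforce simp: A_def)
  then have sets_A: "sets (sigma (space M) A) = sigma_sets (space M) A" by simp
  have V_path: "mono_on {0..} (\<lambda>t. V r t \<omega>)" "V r 0 \<omega> = 0"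
      "\<And>t. t \<ge> 0 \<Longrightarrow> continuous (at_right t) (\<lambda>s. V r s \<omega>)"
    if "r \<in> {1..n}" "\<omega> \<in> space M" for r \<omega>
    using V[OF that(1)] that(2)
    by (auto simp: stable_subordinator_def subordinator_def increasing_rc_paths_def)
  have V0: "V r s \<omega> \<ge> 0" if "r \<in> {1..n}" "\<omega> \<in> space M" "s \<ge> 0" for r s \<omega>
    using V_path(1,2)[OF that(1,2)] that(3) mono_onD[of "{0..}" "\<lambda>t. V r t \<omega>" 0 s] by simp
  have X0: "X s \<omega> \<ge> 0" if "\<omega> \<in> space M" "s \<ge> 0" for s \<omega>
    unfolding X_def stable_mixture_def using that by (intro sum_nonneg mult_nonneg_nonneg V0) auto
  have W0: "W t \<omega> \<ge> 0" if "\<omega> \<in> space M" for \<omega>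
  proof -
    have "mono_on {0..} (\<lambda>t. W t \<omega>)" "W 0 \<omega> = 0"
      using W(1) that by (auto simp: subordinator_def increasing_rc_paths_def)
    then show ?thesis using \<open>t \<ge> 0\<close> mono_onD[of "{0..}" "\<lambda>t. W t \<omega>" 0 t] by simp
  qed
  have [measurable]: "W t \<in> borel_measurable M" using W(1) \<open>t \<ge> 0\<close> by (simp add: subordinator_def)
  have Y_eq: "Y \<omega> = X (W t \<omega>) \<omega>" for \<omega> by (simp add: Y_def time_change_def X_def)
  show Y0: "Y \<omega> \<ge> 0" if "\<omega> \<in> space M" for \<omega>
    using that X0 W0 by (simp add: Y_eq)
  \<comment> \<open>Measurability is required relative to the sigma-algebra of the stable family,
    since that one is independent of \<open>W\<close>.\<close>
  have X_meas: "X s \<in> borel_measurable (sigma (space M) A)" if "s \<ge> 0" for s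
  proof -
    have "V r s \<in> borel_measurable (sigma (space M) A)" if "r \<in> {1..n}" for r
    proof (rule measurableI)
      fix S :: "real set" assume "S \<in> sets borel"
      then have "V r s -` S \<inter> space M \<in> A"
        using that \<open>s \<ge> 0\<close> vimage_in_process_events[of s S "V r" M] by (auto simp: A_def)
      then show "V r s -` S \<inter> space (sigma (space M) A) \<in> sets (sigma (space M) A)"
        using sets_A \<open>A \<subseteq> Pow (space M)\<close> by (simp add: sigma_sets.Basic space_measure_of)
    qed simp
    then show ?thesis unfolding X_def stable_mixture_def by measurable
  qed
  have random_time:
    "(\<lambda>\<omega>. exp (- (x * X (W t \<omega>) \<omega>))) \<in> borel_measurable M \<and>
     expectation (\<lambda>\<omega>. exp (- (x * X (W t \<omega>) \<omega>))) =
       expectation (\<lambda>\<omega>. exp (- W t \<omega> * ((\<eta> + x powr \<nu>) ^ n - \<eta> ^ n)))"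
    if "x \<ge> 0" for x
  proof (rule expectation_random_time[where Z = "\<lambda>s \<omega>. exp (- (x * X s \<omega>))" and T = "W t" and B = 1
        and \<psi> = "\<lambda>s. exp (- s * ((\<eta> + x powr \<nu>) ^ n - \<eta> ^ n))"])
    show "indep_var borel (\<lambda>\<omega>. exp (- (x * X s \<omega>))) borel (W t)" if "s \<ge> 0" for s
    proof (rule indep_var_of_indep_set)
      show "indep_set (sigma_sets (space M) A)
          (sigma_sets (space M) (\<Union>t\<in>{0..}. {W t -` B \<inter> space M | B. B \<in> sets borel}))"
        using indep_set_commute[OF indW] unfolding fam process_events_def .
      have "(\<lambda>\<omega>. exp (- (x * X s \<omega>))) \<in> borel_measurable (sigma (space M) A)"
        using X_meas[OF that] by measurable
      from measurable_sets[OF this] sets_A \<open>A \<subseteq> Pow (space M)\<close>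
      show "(\<lambda>\<omega>. exp (- (x * X s \<omega>))) -` S \<inter> space M \<in> sigma_sets (space M) A"
        if "S \<in> sets borel" for S
        using that by (simp add: space_measure_of)
      show "W t -` S \<inter> space M \<in> sigma_sets (space M) (\<Union>t\<in>{0..}. {W t -` B \<inter> space M | B. B \<in> sets borel})"
        if "S \<in> sets borel" for S
        using vimage_in_process_events[OF \<open>t \<ge> 0\<close> that, of W M] by (simp add: process_events_def)
    qed auto
    show "expectation (\<lambda>\<omega>. exp (- (x * X s \<omega>))) = exp (- s * ((\<eta> + x powr \<nu>) ^ n - \<eta> ^ n))"
      if "s \<ge> 0" for s
      unfolding X_def by (rule stable_mixture_laplace) (use assms that \<open>x \<ge> 0\<close> in auto)
    show "0 \<le> exp (- (x * X s \<omega>))" "exp (- (x * X s \<omega>)) \<le> 1" if "s \<ge> 0" "\<omega> \<in> space M" for s \<omega>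
      using X0[OF that(2,1)] \<open>x \<ge> 0\<close> by simp_all
    show "continuous (at_right s) (\<lambda>s. exp (- (x * X s \<omega>)))" if "s \<ge> 0" "\<omega> \<in> space M" for s \<omega>
      unfolding X_def stable_mixture_def
      by (intro continuous_intros continuous_sum V_path(3)) (use that in auto)
    show "continuous (at_right s) (\<lambda>s. exp (- s * ((\<eta> + x powr \<nu>) ^ n - \<eta> ^ n)))" for s
      by (intro continuous_intros)
  qed (use W0 in auto)
  \<comment> \<open>Measurability at a random time is available for the bounded transform; the
    logarithm recovers \<open>Y\<close> from it.\<close>
  from random_time[of 1] have "(\<lambda>\<omega>. - ln (exp (- (1 * Y \<omega>)))) \<in> borel_measurable M"
    unfolding Y_eq by (intro borel_measurable_uminus borel_measurable_ln) auto
  then show "Y \<in> borel_measurable M" by simp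
  fix x :: real assume "x \<ge> 0"
  define \<mu> where "\<mu> = (\<eta> + x powr \<nu>) ^ n - \<eta> ^ n"
  have "\<mu> \<ge> 0" using \<open>\<eta> > 0\<close> by (simp add: \<mu>_def power_mono)
  have "expectation (\<lambda>\<omega>. exp (- x * Y \<omega>)) = expectation (\<lambda>\<omega>. exp (- \<mu> * W t \<omega>))"
    using random_time[OF \<open>x \<ge> 0\<close>, folded \<mu>_def] by (simp add: Y_eq mult.commute)
  also have "\<dots> = exp (- t * ((\<eta> ^ n + \<mu>) powr (\<delta> / real n) - \<eta> powr \<delta>))"
    using W(2) \<open>t \<ge> 0\<close> \<open>\<mu> \<ge> 0\<close> unfolding has_laplace_exponent_def by blast
  also have "(\<eta> ^ n + \<mu>) powr (\<delta> / real n) = (\<eta> + x powr \<nu>) powr \<delta>"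
  proof -
    have "\<eta> + x powr \<nu> > 0" using \<open>\<eta> > 0\<close> by (simp add: add_pos_nonneg)
    then have "\<eta> ^ n + \<mu> = (\<eta> + x powr \<nu>) powr real n" by (simp add: \<mu>_def powr_realpow)
    then show ?thesis using \<open>n > 0\<close> by (simp add: powr_powr)
  qed
  also have "exp (- t * ((\<eta> + x powr \<nu>) powr \<delta> - \<eta> powr \<delta>))
      = exp (t * \<eta> powr \<delta>) * exp (- t * (\<eta> + x powr \<nu>) powr \<delta>)"
    by (simp add: exp_add[symmetric] algebra_simps)
  finally show "expectation (\<lambda>\<omega>. exp (- x * Y \<omega>))
      = exp (t * \<eta> powr \<delta>) * exp (- t * (\<eta> + x powr \<nu>) powr \<delta>)" .
qed

section \<open>The Poisson process at the subordinated time\<close>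

lemma poisson_process_prob:
  assumes "prob_space M" "poisson_process M rate N" "rate > 0" "s \<ge> 0"
  shows "prob_space.prob M {\<omega> \<in> space M. N s \<omega> = k} = exp (- (rate * s)) * ((rate * s) ^ k / fact k)"
proof (cases "s = 0")
  \<comment> \<open>The increment law covers only intervals of positive length; at time 0 the
    formula reads 0^k / k! with 0^0 = 1.\<close>
  case True
  interpret prob_space M by fact
  have "{\<omega> \<in> space M. N 0 \<omega> = k} = (if k = 0 then space M else {})"
    using assms by (auto simp: poisson_process_def)
  then show ?thesis using True by (simp add: prob_space)
next
  case False
  interpret prob_space M by fact
  have [measurable]: "N s \<in> measurable M (count_space UNIV)" "N 0 \<in> measurable M (count_space UNIV)"
    using assms by (auto simp: poisson_process_def)
  have N0: "N 0 \<omega> = 0" if "\<omega> \<in> space M" for \<omega> using assms that by (simp add: poisson_process_def)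
  have "distr M (count_space UNIV) (\<lambda>\<omega>. N (0 + s) \<omega> - N 0 \<omega>) = measure_pmf (poisson_pmf (rate * s))"
  proof -
    have "\<forall>u\<ge>0. \<forall>h>0. distr M (count_space UNIV) (\<lambda>\<omega>. N (u + h) \<omega> - N u \<omega>)
        = measure_pmf (poisson_pmf (rate * h))"
      using assms(2) by (simp add: poisson_process_def)
    from this[rule_format, of 0 s] show ?thesis using assms False by simp
  qed
  then have "measure (distr M (count_space UNIV) (\<lambda>\<omega>. N s \<omega> - N 0 \<omega>)) {k} = pmf (poisson_pmf (rate * s)) k"
    by (simp add: measure_pmf_single)
  also have "measure (distr M (count_space UNIV) (\<lambda>\<omega>. N s \<omega> - N 0 \<omega>)) {k}
      = measure M ((\<lambda>\<omega>. N s \<omega> - N 0 \<omega>) -` {k} \<inter> space M)"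
    by (intro measure_distr) auto
  also have "(\<lambda>\<omega>. N s \<omega> - N 0 \<omega>) -` {k} \<inter> space M = {\<omega> \<in> space M. N s \<omega> = k}"
    using N0 by auto
  finally show ?thesis using assms False pmf_poisson[of "rate * s" k] by simp
qed

text \<open>The random-time lemma is applied to the indicator of \<open>N s = k\<close>, whose mean
  at a fixed time is the Poisson weight.\<close>

lemma poisson_random_time_prob:
  assumes "prob_space M" "poisson_process M rate N" "rate > 0"
    and ind: "prob_space.indep_set M (process_events M N) (process_events M U)"
    and U0: "\<And>\<omega>. \<omega> \<in> space M \<Longrightarrow> U t \<omega> \<ge> 0" and "t \<ge> 0"
  shows "prob_space.prob M {\<omega> \<in> space M. time_change N U t \<omega> = k} = prob_space.mixed_poisson M (U t) k rate"
proof -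
  interpret prob_space M by fact
  define Z where "Z = (\<lambda>s \<omega>. indicator {k} (N s \<omega>) :: real)"
  have "(\<lambda>\<omega>. Z (U t \<omega>) \<omega>) \<in> borel_measurable M \<and>
      expectation (\<lambda>\<omega>. Z (U t \<omega>) \<omega>) = expectation (\<lambda>\<omega>. exp (- (rate * U t \<omega>)) * ((rate * U t \<omega>) ^ k / fact k))"
  proof (rule expectation_random_time[where Z = Z and T = "U t" and B = 1
        and \<psi> = "\<lambda>s. exp (- (rate * s)) * ((rate * s) ^ k / fact k)"])
    show "indep_var borel (Z s) borel (U t)" if "s \<ge> 0" for s
    proof (rule indep_var_of_indep_set[OF ind[unfolded process_events_def]])
      show "Z s -` S \<inter> space M
          \<in> sigma_sets (space M) (\<Union>t\<in>{0..}. {N t -` B \<inter> space M | B. B \<in> sets borel})" for S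
      proof -
        have "Z s -` S \<inter> space M = N s -` {j. indicator {k} j \<in> S} \<inter> space M"
          by (auto simp: Z_def)
        then show ?thesis
          using vimage_in_process_events[OF \<open>s \<ge> 0\<close>, of "{j. indicator {k} j \<in> S}" N M]
          by (simp add: process_events_def sets_borel_eq_count_space)
      qed
      show "U t -` S \<inter> space M \<in> sigma_sets (space M) (\<Union>t\<in>{0..}. {U t -` B \<inter> space M | B. B \<in> sets borel})"
        if "S \<in> sets borel" for S
        using vimage_in_process_events[OF \<open>t \<ge> 0\<close> that, of U M] by (simp add: process_events_def)
    qed auto
    show "expectation (Z s) = exp (- (rate * s)) * ((rate * s) ^ k / fact k)" if "s \<ge> 0" for s
    proof -
      have "expectation (Z s) = expectation (indicator {\<omega> \<in> space M. N s \<omega> = k})"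
        by (intro Bochner_Integration.integral_cong) (auto simp: Z_def indicator_def)
      then show ?thesis using poisson_process_prob[OF assms(1-3) that, of k]
        by (simp add: Int_absorb2 subset_iff)
    qed
    show "0 \<le> Z s \<omega>" "Z s \<omega> \<le> 1" for s \<omega> by (simp_all add: Z_def indicator_def)
    show "continuous (at_right s) (\<lambda>s. Z s \<omega>)" if "s \<ge> 0" "\<omega> \<in> space M" for s \<omega>
    proof -
      have "((\<lambda>s. N s \<omega>) \<longlongrightarrow> N s \<omega>) (at_right s)"
        using assms(2) that by (simp add: poisson_process_def increasing_rc_paths_def continuous_within)
      \<comment> \<open>A right-continuous path with discrete values is locally constant to the
        right, so the indicator is right-continuous too.\<close>
      then have "eventually (\<lambda>u. N u \<omega> = N s \<omega>) (at_right s)"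
        by (simp add: tendsto_discrete)
      then have "eventually (\<lambda>u. Z u \<omega> = Z s \<omega>) (at_right s)"
        by eventually_elim (simp add: Z_def)
      then show ?thesis unfolding continuous_within by (rule tendsto_eventually)
    qed
    show "continuous (at_right s) (\<lambda>s. exp (- (rate * s)) * ((rate * s) ^ k / fact k))" for s
      by (intro continuous_intros) auto
  qed (use U0 in auto)
  moreover have "expectation (\<lambda>\<omega>. Z (U t \<omega>) \<omega>)
      = expectation (indicator {\<omega> \<in> space M. time_change N U t \<omega> = k})"
    by (intro Bochner_Integration.integral_cong) (auto simp: Z_def indicator_def time_change_def)
  ultimately show ?thesis
    by (simp add: mixed_poisson_def Int_absorb2 subset_iff)
qed

text \<open>The formula is tied to convergence of the outer series because \<open>suminf\<close> of
  a divergent series carries no information. For non-integer \<delta> the expansion in x^\<nu> /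
  \<eta> is guaranteed only below 1, which explains the convergence clause.\<close>

theorem theorem3p2:
  fixes M :: "'a measure"
    and \<delta> \<eta> rate \<nu> :: real
    and n :: nat
    and V :: "nat \<Rightarrow> real \<Rightarrow> 'a \<Rightarrow> real"
    and W :: "real \<Rightarrow> 'a \<Rightarrow> real"
    and U :: "real \<Rightarrow> 'a \<Rightarrow> real"
    and N :: "real \<Rightarrow> 'a \<Rightarrow> nat"
  assumes "prob_space M"
    and "\<delta> > 0" and "\<eta> > 0" and "rate > 0"
    and "n = nat \<lceil>\<delta>\<rceil>"
    and "\<nu> > 0" and "\<nu> * real n < 1"
    and "\<And>r. r \<in> {1..n} \<Longrightarrow> stable_subordinator M (\<nu> * real r) (V r)"
    and "prob_space.indep_sets M (\<lambda>r. process_events M (V r)) {1..n}"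
    and "subordinator M W"
    and "has_laplace_exponent M W (\<lambda>\<mu>. (\<eta> ^ n + \<mu>) powr (\<delta> / real n) - \<eta> powr \<delta>)"
    and "prob_space.indep_set M (process_events M W) (family_events M {1..n} V)"
    and "U = time_change (stable_mixture \<eta> \<nu> n V) W"
    and "poisson_process M rate N"
    and "prob_space.indep_set M (process_events M N) (process_events M U)"
  shows "\<forall>k t. t \<ge> 0 \<longrightarrow>
    (let p = prob_space.prob M {\<omega> \<in> space M. time_change N U t \<omega> = k};
         inner = (\<lambda>m r. (- t * \<eta> powr \<delta>) ^ r * Gamma (real r * \<delta> + 1)
                   * rGamma (real r * \<delta> - real m + 1) / fact r);
         coeff = (\<lambda>m. Gamma (\<nu> * real m + 1) * rGamma (\<nu> * real m - real k + 1) / fact m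
                   * (rate powr \<nu> / \<eta>) ^ m);
         outer = (\<lambda>m. coeff m * (\<Sum>r. inner m r))
     in (\<forall>m. summable (inner m))
      \<and> (rate powr \<nu> < \<eta> \<or> \<delta> \<in> \<nat> \<longrightarrow> summable outer)
      \<and> (summable outer \<longrightarrow>
           p = exp (t * \<eta> powr \<delta>) * ((-1) ^ k / fact k) * (\<Sum>m. outer m))
      \<and> exp (t * \<eta> powr \<delta>) * ((-1) ^ k / fact k) * (\<Sum>m. outer m)
          = exp (t * \<eta> powr \<delta>) * ((-1) ^ k / fact k)
              * (\<Sum>m. coeff m * wright_1psi1 1 \<delta> (1 - real m) \<delta> (- (\<eta> powr \<delta>) * t)))"
proof (intro allI impI)
  fix k :: nat and t :: real assume "t \<ge> 0"
  interpret prob_space M by fact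
  define x where "x = - t * \<eta> powr \<delta>"
  define c where "c = (\<lambda>m. \<Sum>r. x ^ r / fact r * (real r * \<delta> gchoose m))"
  define z where "z = rate powr \<nu> / \<eta>"
  define a where "a = (\<lambda>m. c m * z ^ m * (\<nu> * real m gchoose k))"
  define inner where "inner = (\<lambda>m r. x ^ r * Gamma (real r * \<delta> + 1)
      * rGamma (real r * \<delta> - real m + 1) / fact r)"
  define coeff where "coeff = (\<lambda>m. Gamma (\<nu> * real m + 1) * rGamma (\<nu> * real m - real k + 1) / fact m * z ^ m)"
  have "n > 0" using assms by simp
  have z: "z > 0" "z < 1 \<longleftrightarrow> rate powr \<nu> < \<eta>" using assms by (auto simp: z_def field_simps)
  \<comment> \<open>The terms do not involve \<open>w\<close>, so any point of (0, 1) may be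
    inserted; 1/2 is one choice.\<close>
  have terms_summable: "summable (\<lambda>r. x ^ r / fact r * (real r * \<delta> gchoose m))" for m
    using exp_powr_coeff(1)[of \<delta> "1 / 2" x m] \<open>\<delta> > 0\<close> by simp
  have inner_eq: "inner m = (\<lambda>r. fact m * (x ^ r / fact r * (real r * \<delta> gchoose m)))" for m
  proof
    fix r
    have "real r * \<delta> > -1" using \<open>\<delta> > 0\<close> by (smt (verit) mult_nonneg_nonneg of_nat_0_le_iff)
    from Gamma_rGamma_eq_gbinomial[OF this, of m]
    show "inner m r = fact m * (x ^ r / fact r * (real r * \<delta> gchoose m))"
      by (simp add: inner_def mult.assoc)
  qed
  have inner_summable: "summable (inner m)" for m
    unfolding inner_eq by (intro summable_mult terms_summable)
  have inner_sum: "(\<Sum>r. inner m r) = fact m * c m" for m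
    unfolding inner_eq c_def by (rule suminf_mult[OF terms_summable])
  have coeff_eq: "coeff m = fact k * (\<nu> * real m gchoose k) / fact m * z ^ m" for m
  proof -
    have "\<nu> * real m > -1" using \<open>\<nu> > 0\<close> by (smt (verit) mult_nonneg_nonneg of_nat_0_le_iff)
    from Gamma_rGamma_eq_gbinomial[OF this, of k] show ?thesis by (simp add: coeff_def)
  qed
  \<comment> \<open>The factor m! of the inner sum cancels the denominator of \<open>coeff\<close>;
    the remaining k! later cancels the prefactor 1 / k!.\<close>
  have outer_eq: "(\<lambda>m. coeff m * (\<Sum>r. inner m r)) = (\<lambda>m. fact k * a m)"
    by (simp add: coeff_eq inner_sum a_def fun_eq_iff)
  have outer_summable: "summable (\<lambda>m. coeff m * (\<Sum>r. inner m r)) \<longleftrightarrow> summable a"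
    unfolding outer_eq by (simp add: summable_cmult_iff)
  have sm: "rate powr \<nu> < \<eta> \<or> \<delta> \<in> \<nat> \<Longrightarrow> summable a"
    unfolding a_def c_def x_def using z assms by (intro state_series_summable) auto
  have U: "U t \<in> borel_measurable M" "\<And>\<omega>. \<omega> \<in> space M \<Longrightarrow> U t \<omega> \<ge> 0"
    "\<And>x. x \<ge> 0 \<Longrightarrow> expectation (\<lambda>\<omega>. exp (- x * U t \<omega>))
        = exp (t * \<eta> powr \<delta>) * exp (- t * (\<eta> + x powr \<nu>) powr \<delta>)"
    using subordinated_mixture[OF assms(1-3,6) \<open>n > 0\<close> assms(8-12) \<open>t \<ge> 0\<close>] by (auto simp: assms(13))
  have p: "prob {\<omega> \<in> space M. time_change N U t \<omega> = k} = mixed_poisson (U t) k rate"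
    by (rule poisson_random_time_prob) (use assms U(2) \<open>t \<ge> 0\<close> in auto)
  have p_eq: "prob {\<omega> \<in> space M. time_change N U t \<omega> = k}
      = exp (t * \<eta> powr \<delta>) * ((-1) ^ k / fact k) * (\<Sum>m. coeff m * (\<Sum>r. inner m r))" if "summable a"
  proof -
    \<comment> \<open>Here \<open>q\<close> is \<open>mixed_poisson (U t)\<close>: the rate varies
      while the random time \<open>U t\<close> is kept.\<close>
    have "mixed_poisson (U t) k rate = exp (t * \<eta> powr \<delta>) * ((-1) ^ k * (\<Sum>m. a m))"
      unfolding a_def c_def x_def z_def
    proof (rule generating_function_coefficient)
      fix y s :: real assume "0 < y" "0 \<le> s" "s < 1"
      then show "(\<lambda>k. mixed_poisson (U t) k y * s ^ k) sums
          (exp (t * \<eta> powr \<delta>) * exp (- t * (\<eta> + (y * (1 - s)) powr \<nu>) powr \<delta>))"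
        using mixed_poisson_generating_function[OF U(1,2), of y s] U(3)[of "y * (1 - s)"] by simp
    next
      show "(mixed_poisson (U t) k \<longlongrightarrow> mixed_poisson (U t) k rate) (at_left rate)"
        by (rule mixed_poisson_at_left[OF U(1,2) \<open>rate > 0\<close>])
    qed (use assms(2-4,6) that[unfolded a_def c_def x_def z_def] in simp_all)
    then show ?thesis using suminf_mult[OF that, of "fact k"] by (simp add: p outer_eq)
  qed
  \<comment> \<open>The two series agree term by term, since (1 - m) + \<delta> r = r \<delta> - m +
    1.\<close>
  have wright: "wright_1psi1 1 \<delta> (1 - real m) \<delta> (- (\<eta> powr \<delta>) * t) = (\<Sum>r. inner m r)" for m
    unfolding wright_1psi1_def inner_def x_def by (intro suminf_cong) (simp add: algebra_simps)
  show "let p = prob {\<omega> \<in> space M. time_change N U t \<omega> = k};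
         inner = (\<lambda>m r. (- t * \<eta> powr \<delta>) ^ r * Gamma (real r * \<delta> + 1)
                   * rGamma (real r * \<delta> - real m + 1) / fact r);
         coeff = (\<lambda>m. Gamma (\<nu> * real m + 1) * rGamma (\<nu> * real m - real k + 1) / fact m
                   * (rate powr \<nu> / \<eta>) ^ m);
         outer = (\<lambda>m. coeff m * (\<Sum>r. inner m r))
     in (\<forall>m. summable (inner m))
      \<and> (rate powr \<nu> < \<eta> \<or> \<delta> \<in> \<nat> \<longrightarrow> summable outer)
      \<and> (summable outer \<longrightarrow>
           p = exp (t * \<eta> powr \<delta>) * ((-1) ^ k / fact k) * (\<Sum>m. outer m))
      \<and> exp (t * \<eta> powr \<delta>) * ((-1) ^ k / fact k) * (\<Sum>m. outer m)
          = exp (t * \<eta> powr \<delta>) * ((-1) ^ k / fact k)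
              * (\<Sum>m. coeff m * wright_1psi1 1 \<delta> (1 - real m) \<delta> (- (\<eta> powr \<delta>) * t))"
    unfolding Let_def x_def[symmetric] z_def[symmetric] inner_def[symmetric] coeff_def[symmetric]
      wright outer_summable
    using inner_summable sm p_eq by blast
qed

end
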